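(* Let $A$ be a $C^*$-algebra, let $B$ be a Banach algebra having a bounded approximate identity, and let $\Phi\colon A\to B$ be a surjective continuous linear map such that for all $a,b\in A$, \[ ab=ba=0 \ \implies\ \Phi(a)\circ\Phi(b)=0. \] Then $\Phi$ is a weighted Jordan homomorphism.
   Context: Banach algebras are complex and associative, not assumed unital. Bounded approximate identities are two-sided. The notation $a\circ b$ stands for the Jordan product $ab+ba$. A Jordan homomorphism is a linear map $\Psi\colon A\to B$ with $\Psi(a\circ b)=\Psi(a)\circ\Psi(b)$ for all $a,b\in A$. A centralizer of $B$ is a linear map $W\colon B\to B$ with $W(ab)=W(a)b=aW(b)$ for all $a,b\in B$. A linear map $\Phi\colon A\to B$ is a weighted Jordan homomorphism if there exist an invertible centralizer $W$ of $B$ and a Jordan homomorphism $\Psi$ from $A$ to $B$ such that $\Phi=W\Psi$. *)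

theory Defs
  imports "HOL-Analysis.Analysis"
begin

text \<open>Neither \<^class>\<open>real_normed_algebra\<close> nor \<^class>\<open>banach\<close> assumes a unit. The complex scalar
  multiplication extends the real one of the library, so norm, metric and topology are those of
  \<^class>\<open>banach\<close>.\<close>

class complex_banach_algebra = real_normed_algebra + banach +
  fixes scaleC :: "complex \<Rightarrow> 'a \<Rightarrow> 'a"
  assumes scaleC_add_right: "scaleC c (x + y) = scaleC c x + scaleC c y"
    and scaleC_add_left: "scaleC (c + d) x = scaleC c x + scaleC d x"
    and scaleC_scaleC: "scaleC c (scaleC d x) = scaleC (c * d) x"
    and scaleC_of_real: "scaleC (complex_of_real r) x = scaleR r x"
    and mult_scaleC_left: "scaleC c x * y = scaleC c (x * y)"
    and mult_scaleC_right: "x * scaleC c y = scaleC c (x * y)"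
    and norm_scaleC: "norm (scaleC c x) = cmod c * norm x"

lemma vector_space_scaleC: "vector_space (scaleC :: complex \<Rightarrow> 'a \<Rightarrow> 'a::complex_banach_algebra)"
  by unfold_locales
    (simp_all add: scaleC_add_right scaleC_add_left scaleC_scaleC
      scaleC_of_real[of 1, simplified])

class cstar_algebra = complex_banach_algebra +
  fixes adj :: "'a \<Rightarrow> 'a"
  assumes adj_adj: "adj (adj x) = x"
    and adj_add: "adj (x + y) = adj x + adj y"
    and adj_scaleC: "adj (scaleC c x) = scaleC (cnj c) (adj x)"
    and adj_mult: "adj (x * y) = adj y * adj x"
    and cstar_identity: "norm (adj x * x) = (norm x)\<^sup>2"

instantiation complex :: cstar_algebra
begin

definition scaleC_complex :: "complex \<Rightarrow> complex \<Rightarrow> complex"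
  where "scaleC_complex c x = c * x"

definition adj_complex :: "complex \<Rightarrow> complex"
  where "adj_complex x = cnj x"

instance
  by standard
    (simp_all add: scaleC_complex_def adj_complex_def algebra_simps norm_mult scaleR_conv_of_real
      power2_eq_square)

end

abbreviation clinear :: "('a::complex_banach_algebra \<Rightarrow> 'b::complex_banach_algebra) \<Rightarrow> bool"
  where "clinear \<equiv> Vector_Spaces.linear scaleC scaleC"

definition jordan_prod :: "'a::complex_banach_algebra \<Rightarrow> 'a \<Rightarrow> 'a"
  where "jordan_prod a b = a * b + b * a"

definition jordan_hom :: "('a::complex_banach_algebra \<Rightarrow> 'b::complex_banach_algebra) \<Rightarrow> bool"
  where "jordan_hom \<Psi> \<longleftrightarrow>
    clinear \<Psi> \<and> (\<forall>a b. \<Psi> (jordan_prod a b) = jordan_prod (\<Psi> a) (\<Psi> b))"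

definition centralizer :: "('b::complex_banach_algebra \<Rightarrow> 'b) \<Rightarrow> bool"
  where "centralizer W \<longleftrightarrow>
    clinear W \<and> (\<forall>a b. W (a * b) = W a * b \<and> W (a * b) = a * W b)"

definition weighted_jordan_hom ::
    "('a::complex_banach_algebra \<Rightarrow> 'b::complex_banach_algebra) \<Rightarrow> bool"
  where "weighted_jordan_hom \<Phi> \<longleftrightarrow>
    clinear \<Phi> \<and> (\<exists>W \<Psi>. centralizer W \<and> bij W \<and> jordan_hom \<Psi> \<and> \<Phi> = W \<circ> \<Psi>)"

definition directed_by :: "'i set \<Rightarrow> ('i \<Rightarrow> 'i \<Rightarrow> bool) \<Rightarrow> bool"
  where "directed_by I le \<longleftrightarrow>
    I \<noteq> {} \<and>
    (\<forall>i\<in>I. le i i) \<and>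
    (\<forall>i\<in>I. \<forall>j\<in>I. \<forall>k\<in>I. le i j \<longrightarrow> le j k \<longrightarrow> le i k) \<and>
    (\<forall>i\<in>I. \<forall>j\<in>I. \<exists>k\<in>I. le i k \<and> le j k)"

definition net_tendsto ::
    "'i set \<Rightarrow> ('i \<Rightarrow> 'i \<Rightarrow> bool) \<Rightarrow> ('i \<Rightarrow> 'b::real_normed_vector) \<Rightarrow> 'b \<Rightarrow> bool"
  where "net_tendsto I le f l \<longleftrightarrow>
    (\<forall>\<epsilon>>0. \<exists>i\<in>I. \<forall>j\<in>I. le i j \<longrightarrow> norm (f j - l) < \<epsilon>)"

text \<open>The index type \<open>'i\<close> is a parameter, since a definition cannot quantify over types. In a
  theorem that assumes this predicate for arbitrary \<open>I\<close>, \<open>le\<close> and \<open>e\<close>, the net may be indexed by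
  any directed set.\<close>

definition bounded_approx_identity ::
    "'i set \<Rightarrow> ('i \<Rightarrow> 'i \<Rightarrow> bool) \<Rightarrow> ('i \<Rightarrow> 'b::complex_banach_algebra) \<Rightarrow> bool"
  where "bounded_approx_identity I le e \<longleftrightarrow>
    directed_by I le \<and>
    (\<exists>C. \<forall>i\<in>I. norm (e i) \<le> C) \<and>
    (\<forall>b. net_tendsto I le (\<lambda>i. e i * b) b \<and> net_tendsto I le (\<lambda>i. b * e i) b)"

end

theory Submission
  imports Defs
begin

text \<open>
  If \<open>A\<close> and \<open>B\<close> were unital with \<open>w = \<Phi>(1)\<close>, one would have
  \<open>2 (\<Phi>(a) \<circ> \<Phi>(b)) = w \<circ> \<Phi>(a \<circ> b)\<close>, and everything would follow once \<open>w\<close> is known to be central.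
  Without units, \<open>w\<close> is replaced by \<open>\<Phi>(u)\<close> along an approximate unit \<open>u\<close> of \<open>A\<close>. Both facts rest on
  one observation about a bounded bilinear \<open>\<psi>\<close> that vanishes on pairs of orthogonal functions of a
  self-adjoint \<open>h\<close>: if \<open>g = 1\<close> on the support of \<open>f\<close>, then \<open>\<psi>(f(h), g(h)) = \<psi>(g(h), f(h))\<close>.
  Applied to \<open>(a, b) \<mapsto> \<Phi>(a x) \<circ> \<Phi>(b)\<close> it shows that \<open>\<Phi>(a) \<circ> \<Phi>(b) = \<sigma>(a \<circ> b)\<close> with
  \<open>\<sigma>(a) = lim (\<Phi>(a) \<circ> \<Phi>(u)) / 2\<close>. Applied to \<open>(a, b) \<mapsto> [\<sigma>(a), \<Phi>(b)]\<close>, together with the identity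
  \<open>[x \<circ> y, z] + [y \<circ> z, x] + [z \<circ> x, y] = 0\<close>, it shows that \<open>[\<sigma>(a), \<Phi>(u)] \<rightarrow> 0\<close>. As the range of \<open>\<sigma>\<close>
  is dense, \<open>\<Phi>(u)\<close> asymptotically commutes with all of \<open>B\<close>, so that \<open>\<Phi>(a) \<Phi>(u) \<rightarrow> \<sigma>(a)\<close>. Hence
  \<open>\<sigma>(a) \<Phi>(b) = \<Phi>(a) \<sigma>(b)\<close>, and \<open>W(\<Phi>(a)) = \<sigma>(a)\<close> defines the required centralizer.
\<close>

section \<open>Polynomials of a self-adjoint contraction\<close>

text \<open>The hypothesis says something only about orthogonal pairs. Functions of one self-adjoint
  \<open>h\<close> with disjoint supports supply enough of them, since every element is a complex
  combination of two self-adjoint ones. The calculus has to do without a unit and without a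
  spectrum; it rests on the bound of \<open>norm (p(h) x)\<close> by \<open>norm x\<close> times the
  maximum of \<open>|p|\<close> on \<open>[-1,1]\<close>.

  The symmetry of \<open>\<psi>\<close> needs a \<open>g\<close> with \<open>g(0) = 0\<close> that
  is \<open>1\<close> on the support of \<open>f\<close>, hence an \<open>f\<close> vanishing near
  \<open>0\<close>. Thresholding approximates \<open>h\<close> by such \<open>f(h)\<close>, and
  \<open>g(h)\<close> is an exact unit for them. The pair \<open>[\<sigma>(a), \<Phi>(b)]\<close>
  vanishes on orthogonal \<open>a\<close>, \<open>b\<close> because \<open>\<Phi>(b)\<close>
  anticommutes with the images of two factors of \<open>a\<close>, hence commutes with their Jordan
  product.

  The range of \<open>W\<close> contains all Jordan products, which makes it dense only. To get all
  of \<open>B\<close>, the bound of the approximate identity and the open mapping theorem provide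
  preimages of controlled norm, and successive approximation does the rest.\<close>

text \<open>There is no unit, so a polynomial \<open>p\<close> in \<open>h\<close> with a constant term only makes sense as an operator
  \<open>x \<mapsto> p(h) x\<close>.\<close>

definition pact :: "real poly \<Rightarrow> 'a::real_normed_algebra \<Rightarrow> 'a \<Rightarrow> 'a"
  where "pact p h x = fold_coeffs (\<lambda>a y. a *\<^sub>R x + h * y) p 0"

lemma pact_0 [simp]: "pact 0 h x = 0"
  by (simp add: pact_def)

lemma pact_pCons [simp]: "pact (pCons a p) h x = a *\<^sub>R x + h * pact p h x"
  by (cases "a = 0 \<and> p = 0") (auto simp: pact_def)

lemma pact_1 [simp]: "pact 1 h x = x"
  by (simp add: one_pCons)

lemma pact_add: "pact (p + q) h x = pact p h x + pact q h x"
  by (induction p q rule: poly_induct2) (simp_all add: algebra_simps)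

lemma pact_smult: "pact (smult c p) h x = c *\<^sub>R pact p h x"
  by (induction p) (simp_all add: algebra_simps)

lemma pact_uminus: "pact (- p) h x = - pact p h x"
  using pact_smult[of "-1" p h x] by simp

lemma pact_diff: "pact (p - q) h x = pact p h x - pact q h x"
  using pact_add[of p "- q" h x] by (simp add: pact_uminus)

lemma pact_mult: "pact (p * q) h x = pact p h (pact q h x)"
  by (induction p) (simp_all add: algebra_simps pact_add pact_smult)

lemma pact_sum: "pact (\<Sum>i\<in>S. f i) h x = (\<Sum>i\<in>S. pact (f i) h x)"
  by (induction S rule: infinite_finite_induct) (simp_all add: pact_add)

lemma pact_commute: "pact p h (h * x) = h * pact p h x"
  by (induction p) (simp_all add: algebra_simps)

lemma pact_times: "pact p h x * y = pact p h (x * y)"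
  by (induction p) (simp_all add: algebra_simps)

lemma pact_add_right: "pact p h (x + y) = pact p h x + pact p h y"
  by (induction p) (simp_all add: algebra_simps)

lemma pact_diff_right: "pact p h (x - y) = pact p h x - pact p h y"
  using pact_add_right[of p h "x - y" y] by simp

lemma pact_nonneg_coeffs:
  assumes "\<forall>i. coeff p i \<ge> 0" "norm h \<le> 1"
  shows "norm (pact p h x) \<le> poly p 1 * norm x \<and> poly p 1 \<ge> 0"
  using assms(1)
proof (induction p)
  case (pCons a p)
  have a: "a \<ge> 0" using pCons.prems[rule_format, of 0] by simp
  have "\<forall>i. coeff p i \<ge> 0"
  proof
    fix i show "coeff p i \<ge> 0" using pCons.prems[rule_format, of "Suc i"] by simp
  qed
  then have IH: "norm (pact p h x) \<le> poly p 1 * norm x" "poly p 1 \<ge> 0" using pCons.IH by auto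
  have "norm (h * pact p h x) \<le> 1 * norm (pact p h x)"
    by (rule order_trans[OF norm_mult_ineq]) (intro mult_right_mono assms(2) norm_ge_zero)
  then have "norm (h * pact p h x) \<le> poly p 1 * norm x" using IH by linarith
  moreover have "norm (a *\<^sub>R x + h * pact p h x) \<le> a * norm x + norm (h * pact p h x)"
    using a norm_triangle_ineq[of "a *\<^sub>R x" "h * pact p h x"] by simp
  ultimately show ?case using a IH by (simp add: algebra_simps)
qed simp

lemma pact_bounded: "\<exists>C\<ge>0. \<forall>x. norm (pact p h x) \<le> C * norm x"
proof (induction p)
  case (pCons a p)
  then obtain C where C: "C \<ge> 0" "\<And>x. norm (pact p h x) \<le> C * norm x" by auto
  have "norm (pact (pCons a p) h x) \<le> (\<bar>a\<bar> + norm h * C) * norm x" for x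
  proof -
    have "norm (h * pact p h x) \<le> norm h * (C * norm x)"
      by (rule order_trans[OF norm_mult_ineq]) (intro mult_left_mono C norm_ge_zero)
    then show ?thesis
      using norm_triangle_ineq[of "a *\<^sub>R x" "h * pact p h x"] by (simp add: algebra_simps)
  qed
  then show ?case using C(1) by (intro exI[of _ "\<bar>a\<bar> + norm h * C"]) auto
qed auto

lemma adj_0 [simp]: "adj 0 = (0::'a::cstar_algebra)"
  using adj_add[of 0 "0::'a"] by simp

lemma adj_minus: "adj (- x) = - adj (x::'a::cstar_algebra)"
  using adj_add[of x "- x"] by (simp add: eq_neg_iff_add_eq_0 add.commute)

lemma adj_diff: "adj (x - y) = adj x - adj (y::'a::cstar_algebra)"
  using adj_add[of x "- y"] by (simp add: adj_minus)

lemma adj_scaleR: "adj (r *\<^sub>R x) = r *\<^sub>R adj (x::'a::cstar_algebra)"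
  by (simp flip: scaleC_of_real add: adj_scaleC)

lemma norm_adj [simp]: "norm (adj x) = norm (x::'a::cstar_algebra)"
proof -
  have "norm x \<le> norm (adj x)" for x :: 'a
  proof (cases "x = 0")
    case False
    have "norm x * norm x \<le> norm (adj x) * norm x"
      using norm_mult_ineq[of "adj x" x] by (simp add: cstar_identity power2_eq_square)
    then show ?thesis using False by simp
  qed simp
  from this[of x] this[of "adj x"] show ?thesis by (simp add: adj_adj)
qed

lemma norm_mult_adj: "norm (x * adj x) = (norm (x::'a::cstar_algebra))\<^sup>2"
  using cstar_identity[of "adj x"] by (simp add: adj_adj)

text \<open>Self-adjointness of the operator \<open>p(h)\<close>, with \<open>adj x * y\<close> in
  the role of an inner product: there is no element \<open>p(h)\<close> to which \<open>adj\<close>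
  could be applied.\<close>

lemma adj_pact_mult:
  fixes h :: "'a::cstar_algebra"
  assumes "adj h = h"
  shows "adj (pact p h x) * y = adj x * pact p h y"
proof (induction p arbitrary: y)
  case (pCons a p)
  have "adj (pact (pCons a p) h x) * y = a *\<^sub>R (adj x * y) + adj (pact p h x) * (h * y)"
    using assms by (simp add: adj_add adj_scaleR adj_mult algebra_simps)
  then show ?case by (simp add: pCons.IH pact_commute algebra_simps)
qed simp

lemma norm_pact_square:
  fixes h :: "'a::cstar_algebra"
  assumes "adj h = h"
  shows "(norm (pact p h x))\<^sup>2 \<le> norm x * norm (pact (p\<^sup>2) h x)"
proof -
  have "adj (pact p h x) * pact p h x = adj x * pact (p\<^sup>2) h x"
    using assms by (simp add: adj_pact_mult pact_mult power2_eq_square)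
  then have "(norm (pact p h x))\<^sup>2 = norm (adj x * pact (p\<^sup>2) h x)"
    using cstar_identity[of "pact p h x"] by simp
  also have "\<dots> \<le> norm x * norm (pact (p\<^sup>2) h x)"
    using norm_mult_ineq[of "adj x"] by simp
  finally show ?thesis .
qed

text \<open>For \<open>s = \<i>\<close> and \<open>s = -\<i>\<close>, let
  \<open>z = p(h) x + s q(h) x\<close>. As \<open>p(h)\<close> and \<open>q(h)\<close> commute, the
  cross terms of \<open>adj z * z\<close> cancel and \<open>adj x * (p^2 + q^2)(h) x\<close>
  remains. This bounds both \<open>z\<close>, and \<open>p(h) x\<close> is their mean.\<close>

lemma norm_sum_two_pact:
  fixes h :: "'a::cstar_algebra"
  assumes "adj h = h" "\<And>y. norm (pact (p\<^sup>2 + q\<^sup>2) h y) \<le> c * norm y" "c \<ge> 0"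
  shows "norm (pact p h x) \<le> sqrt c * norm x"
proof -
  have *: "norm (pact p h x + scaleC s (pact q h x)) \<le> sqrt c * norm x" if "s = \<i> \<or> s = - \<i>" for s
  proof -
    let ?z = "pact p h x + scaleC s (pact q h x)"
    have ss: "cnj s = - s" "s * s = -1" using that by auto
    have comm: "adj x * pact q h (pact p h x) = adj x * pact p h (pact q h x)"
      by (metis mult.commute pact_mult)
    have "adj ?z * ?z = adj x * pact p h (pact p h x) + scaleC s (adj x * pact p h (pact q h x))
        + (scaleC (- s) (adj x * pact q h (pact p h x)) + scaleC (- s * s) (adj x * pact q h (pact q h x)))"
      using assms(1)
      by (simp add: adj_add adj_scaleC ss adj_pact_mult distrib_left distrib_right
          mult_scaleC_left mult_scaleC_right scaleC_scaleC pact_add_right scaleC_add_right)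
    also have "\<dots> = adj x * pact p h (pact p h x) + adj x * pact q h (pact q h x)"
    proof -
      have "scaleC s u + scaleC (- s) u = 0" for u :: 'a
        using scaleC_add_left[of s "-s" u] scaleC_of_real[of 0 u] by simp
      moreover have "scaleC (- s * s) u = u" for u :: 'a
        using ss scaleC_of_real[of 1 u] by simp
      ultimately show ?thesis unfolding comm by (simp add: add.assoc[symmetric]) 
    qed
    also have "\<dots> = adj x * pact (p\<^sup>2 + q\<^sup>2) h x"
      by (simp add: pact_add pact_mult power2_eq_square distrib_left)
    finally have "(norm ?z)\<^sup>2 = norm (adj x * pact (p\<^sup>2 + q\<^sup>2) h x)"
      using cstar_identity[of ?z] by simp
    also have "\<dots> \<le> norm x * (c * norm x)"
      using norm_mult_ineq[of "adj x"] mult_left_mono[OF assms(2)[of x] norm_ge_zero[of x]]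
      by (metis norm_adj order_trans)
    also have "\<dots> = (sqrt c * norm x)\<^sup>2"
      using assms(3) by (simp add: power_mult_distrib power2_eq_square)
    finally show ?thesis
      by (rule power2_le_imp_le) (simp add: assms(3))
  qed
  have "pact p h x + pact p h x = (pact p h x + scaleC \<i> (pact q h x)) + (pact p h x + scaleC (- \<i>) (pact q h x))"
    using scaleC_add_left[of \<i> "-\<i>" "pact q h x"] scaleC_of_real[of 0 "pact q h x"]
    by (simp add: algebra_simps)
  then have "2 *\<^sub>R pact p h x = (pact p h x + scaleC \<i> (pact q h x)) + (pact p h x + scaleC (- \<i>) (pact q h x))"
    by (simp add: scaleR_2)
  then have "norm (2 *\<^sub>R pact p h x) \<le> sqrt c * norm x + sqrt c * norm x"
    using *[of \<i>] *[of "-\<i>"] norm_triangle_mono by metis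
  then show ?thesis by simp
qed

section \<open>Polynomial approximation of \<open>sqrt (1 - t^2)\<close>\<close>

definition sq_poly :: "real poly" where "sq_poly = [:0, 0, 1:]"

text \<open>The iterates \<open>Y \<leftarrow> (t\<^sup>2 + Y\<^sup>2) / 2\<close> approximate \<open>1 - sqrt (1 - t\<^sup>2)\<close>. Their increments have
  nonnegative coefficients, so evaluating an increment at a contraction is bounded by its value at
  \<open>1\<close>.\<close>

fun sqrt_iter :: "nat \<Rightarrow> real poly"
  where
    "sqrt_iter 0 = 0"
  | "sqrt_iter (Suc n) = smult (1/2) (sq_poly + (sqrt_iter n)\<^sup>2)"

lemma coeff_mult_nonneg:
  fixes p q :: "real poly"
  assumes "\<forall>i. coeff p i \<ge> 0" "\<forall>i. coeff q i \<ge> 0"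
  shows "coeff (p * q) i \<ge> 0"
  unfolding coeff_mult using assms by (intro sum_nonneg mult_nonneg_nonneg) auto

lemma coeff_sqrt_iter_nonneg: "coeff (sqrt_iter n) i \<ge> 0"
proof (induction n arbitrary: i)
  case (Suc n)
  have "coeff ((sqrt_iter n)\<^sup>2) i \<ge> 0"
    unfolding power2_eq_square using Suc.IH by (intro coeff_mult_nonneg) auto
  moreover have "coeff sq_poly i \<ge> 0"
    by (auto simp: sq_poly_def coeff_pCons split: nat.split)
  ultimately show ?case by simp
qed simp

lemma coeff_sqrt_iter_diff_nonneg: "coeff (sqrt_iter (Suc n) - sqrt_iter n) i \<ge> 0"
proof (induction n arbitrary: i)
  case 0
  show ?case using coeff_sqrt_iter_nonneg[of "Suc 0" i] by simp
next
  case (Suc n)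
  have "sqrt_iter (Suc (Suc n)) - sqrt_iter (Suc n)
      = smult (1/2) ((sqrt_iter (Suc n))\<^sup>2 - (sqrt_iter n)\<^sup>2)"
    unfolding sqrt_iter.simps(2)[of "Suc n"] sqrt_iter.simps(2)[of n]
    by (simp only: smult_diff_right[symmetric]) simp
  also have "(sqrt_iter (Suc n))\<^sup>2 - (sqrt_iter n)\<^sup>2
      = (sqrt_iter (Suc n) - sqrt_iter n) * (sqrt_iter (Suc n) + sqrt_iter n)"
    by (simp only: power2_eq_square) (simp add: algebra_simps)
  finally have eq: "sqrt_iter (Suc (Suc n)) - sqrt_iter (Suc n)
      = smult (1/2) ((sqrt_iter (Suc n) - sqrt_iter n) * (sqrt_iter (Suc n) + sqrt_iter n))" .
  have "coeff ((sqrt_iter (Suc n) - sqrt_iter n) * (sqrt_iter (Suc n) + sqrt_iter n)) i \<ge> 0"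
  proof (rule coeff_mult_nonneg)
    show "\<forall>i. coeff (sqrt_iter (Suc n) + sqrt_iter n) i \<ge> 0"
      using coeff_sqrt_iter_nonneg by (metis add_nonneg_nonneg coeff_add)
  qed (use Suc.IH in blast)
  then show ?case unfolding eq by simp
qed

text \<open>The defect of \<open>1 - Y\<close> as a square root of \<open>1 - t^2\<close> is exactly
  twice the next increment of the iteration, so bounds on increments are all that is needed.\<close>

lemma sqrt_iter_square:
  "(1 - sqrt_iter n)\<^sup>2 = 1 - sq_poly + smult 2 (sqrt_iter (Suc n) - sqrt_iter n)"
proof -
  have "smult 2 (sqrt_iter (Suc n)) = sq_poly + (sqrt_iter n)\<^sup>2" by simp
  then have "smult 2 (sqrt_iter (Suc n) - sqrt_iter n) = sq_poly + (sqrt_iter n)\<^sup>2 - smult 2 (sqrt_iter n)"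
    by (simp only: smult_diff_right)
  moreover have "smult 2 (sqrt_iter n) = sqrt_iter n + sqrt_iter n"
    by (metis one_add_one smult_add_left smult_1_left)
  moreover have "(1 - sqrt_iter n)\<^sup>2 = 1 - (sqrt_iter n + sqrt_iter n) + (sqrt_iter n)\<^sup>2"
    by (simp add: power2_eq_square algebra_simps)
  ultimately show ?thesis by simp
qed

text \<open>At \<open>t = 1\<close> the iteration reads \<open>y \<leftarrow> (1 + y^2) / 2\<close>;
  it increases, stays below \<open>1\<close>, and its only fixed point is \<open>1\<close>. Hence
  the increments at \<open>1\<close>, which dominate their norms at any contraction, tend to
  \<open>0\<close>.\<close>

lemma sqrt_iter_at_1: "(\<lambda>n. poly (sqrt_iter n) 1) \<longlonglongrightarrow> 1"
proof -
  let ?y = "\<lambda>n. poly (sqrt_iter n) 1"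
  have S: "?y (Suc n) = (1 + (?y n)\<^sup>2) / 2" for n
    by (simp add: sq_poly_def)
  have bd: "0 \<le> ?y n \<and> ?y n \<le> 1" for n
  proof (induction n)
    case (Suc n)
    then have "(?y n)\<^sup>2 \<le> 1" by (simp add: power_le_one)
    then show ?case unfolding S by auto
  qed simp
  have "incseq ?y"
  proof (rule incseq_SucI)
    fix n
    have "0 \<le> (1 - ?y n)\<^sup>2" by simp
    then show "?y n \<le> ?y (Suc n)" unfolding S by (simp add: power2_eq_square algebra_simps)
  qed
  then obtain L where L: "?y \<longlonglongrightarrow> L"
    by (rule incseq_convergent[of ?y 1]) (use bd in auto)
  then have "(\<lambda>n. ?y (Suc n)) \<longlonglongrightarrow> L" by (rule LIMSEQ_Suc)
  moreover have "(\<lambda>n. ?y (Suc n)) \<longlonglongrightarrow> (1 + L\<^sup>2) / 2"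
    unfolding S by (intro tendsto_intros L) simp
  ultimately have "L = (1 + L\<^sup>2) / 2" by (rule LIMSEQ_unique)
  then have "2 * L = 1 + L\<^sup>2" by (simp add: field_simps)
  then have "(L - 1)\<^sup>2 = 0" by (simp add: power2_diff)
  then show ?thesis using L by simp
qed

section \<open>Chebyshev polynomials and the supremum bound for polynomials\<close>

text \<open>\<open>cheb n\<close> is the Chebyshev polynomial \<open>T\<^sub>n\<close>, while \<open>cheb2 n\<close> is \<open>U\<^bsub>n-1\<^esub>\<close>.\<close>

fun cheb :: "nat \<Rightarrow> real poly" and cheb2 :: "nat \<Rightarrow> real poly"
  where
    "cheb 0 = 1"
  | "cheb2 0 = 0"
  | "cheb (Suc n) = pCons 0 (cheb n) - (1 - sq_poly) * cheb2 n"
  | "cheb2 (Suc n) = pCons 0 (cheb2 n) + cheb n"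

lemma pCons_0_mult: "pCons 0 p = monom 1 1 * (p :: real poly)"
  by (simp add: monom_altdef)

lemma sq_poly_eq: "sq_poly = monom 1 1 * monom 1 1"
  by (simp add: sq_poly_def monom_altdef)

lemma cheb_pell: "(cheb n)\<^sup>2 + (1 - sq_poly) * (cheb2 n)\<^sup>2 = 1"
proof (induction n)
  case (Suc n)
  have "(cheb (Suc n))\<^sup>2 + (1 - sq_poly) * (cheb2 (Suc n))\<^sup>2
      = (cheb n)\<^sup>2 + (1 - sq_poly) * (cheb2 n)\<^sup>2"
    unfolding cheb.simps cheb2.simps pCons_0_mult sq_poly_eq by algebra
  then show ?case using Suc.IH by simp
qed simp

text \<open>The three-term recurrence, obtained by eliminating \<open>cheb2\<close>. It shows that
  multiplication by \<open>t\<close> raises the index in a Chebyshev expansion by at most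
  one.\<close>

lemma cheb_Suc_Suc: "pCons 0 (cheb (Suc n)) = smult (1/2) (cheb (Suc (Suc n))) + smult (1/2) (cheb n)"
proof -
  have "smult 2 (pCons 0 (cheb (Suc n))) = cheb (Suc (Suc n)) + cheb n"
  proof -
    have "smult 2 (pCons 0 (cheb (Suc n))) = pCons 0 (cheb (Suc n)) + pCons 0 (cheb (Suc n))"
      by (metis one_add_one smult_add_left smult_1_left)
    also have "\<dots> = cheb (Suc (Suc n)) + cheb n"
      unfolding cheb.simps cheb2.simps pCons_0_mult sq_poly_eq by algebra
    finally show ?thesis .
  qed
  then have "smult (1/2) (smult 2 (pCons 0 (cheb (Suc n)))) = smult (1/2) (cheb (Suc (Suc n)) + cheb n)"
    by simp
  then show ?thesis by (simp only: smult_smult smult_add_right) simp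
qed

lemma poly_cheb_cos: "poly (cheb n) (cos t) = cos (n * t) \<and> poly (cheb2 n) (cos t) * sin t = sin (n * t)"
proof (induction n)
  case (Suc n)
  have "1 - cos t * cos t = sin t * sin t"
    using sin_cos_squared_add[of t] by (simp add: power2_eq_square)
  then have "(1 - cos t * cos t) * poly (cheb2 n) (cos t) = sin t * (poly (cheb2 n) (cos t) * sin t)"
    by (simp add: mult_ac)
  with Suc.IH show ?case
    by (simp add: sq_poly_def algebra_simps cos_add sin_add distrib_right)
qed simp

text \<open>If \<open>s\<^sup>2\<close> is close to \<open>1 - t\<^sup>2\<close>, then \<open>T\<^sub>n\<^sup>2 + (s U)\<^sup>2\<close> is close to \<open>1\<close> by the Pell equation, so that
  \<open>T\<^sub>n \<plusminus> i s U\<close> is almost isometric.\<close>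

lemma norm_pact_cheb:
  fixes h :: "'a::cstar_algebra"
  assumes "adj h = h" "norm h \<le> 1"
  shows "norm (pact (cheb n) h x) \<le> norm x"
proof -
  \<comment> \<open>\<open>C\<close> depends on \<open>n\<close> and may be huge. It only ever
    multiplies an increment of the square root iteration, which tends to \<open>0\<close> in
    \<open>k\<close> while \<open>n\<close> is fixed.\<close>
  obtain C where C: "C \<ge> 0" "\<And>x. norm (pact ((cheb2 n)\<^sup>2) h x) \<le> C * norm x"
    using pact_bounded[of "(cheb2 n)\<^sup>2" h] by auto
  define y where "y = (\<lambda>k. poly (sqrt_iter k) 1)"
  define d where "d = (\<lambda>k. 2 * (y (Suc k) - y k) * C)"
  have dpos: "y (Suc k) - y k \<ge> 0" for k
    using pact_nonneg_coeffs[of "sqrt_iter (Suc k) - sqrt_iter k" h]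
      coeff_sqrt_iter_diff_nonneg[of k] assms(2)
    by (metis poly_diff y_def)
  have *: "norm (pact (cheb n) h x) \<le> sqrt (1 + d k) * norm x" for k
  proof (rule norm_sum_two_pact[OF assms(1), where q = "(1 - sqrt_iter k) * cheb2 n"])
    show "1 + d k \<ge> 0" using C dpos[of k] by (simp add: d_def)
    fix z
    let ?r = "sqrt_iter (Suc k) - sqrt_iter k"
    have "(cheb n)\<^sup>2 + ((1 - sqrt_iter k) * cheb2 n)\<^sup>2 = 1 + smult 2 ?r * (cheb2 n)\<^sup>2"
      unfolding power_mult_distrib sqrt_iter_square
      using cheb_pell[of n] by (simp add: algebra_simps)
    then have "pact ((cheb n)\<^sup>2 + ((1 - sqrt_iter k) * cheb2 n)\<^sup>2) h z
        = z + 2 *\<^sub>R pact ?r h (pact ((cheb2 n)\<^sup>2) h z)"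
      by (simp only: pact_add pact_mult pact_smult pact_1)
    moreover have "norm (pact ?r h (pact ((cheb2 n)\<^sup>2) h z)) \<le> (y (Suc k) - y k) * (C * norm z)"
    proof -
      have "norm (pact ?r h (pact ((cheb2 n)\<^sup>2) h z)) \<le> poly ?r 1 * norm (pact ((cheb2 n)\<^sup>2) h z)"
        using pact_nonneg_coeffs[of ?r h] coeff_sqrt_iter_diff_nonneg[of k] assms(2) by blast
      also have "\<dots> \<le> (y (Suc k) - y k) * (C * norm z)"
        using C(2)[of z] dpos[of k] by (simp only: poly_diff y_def mult_left_mono)
      finally show ?thesis .
    qed
    ultimately show "norm (pact ((cheb n)\<^sup>2 + ((1 - sqrt_iter k) * cheb2 n)\<^sup>2) h z) \<le> (1 + d k) * norm z"
      using norm_triangle_ineq[of z "2 *\<^sub>R pact ?r h (pact ((cheb2 n)\<^sup>2) h z)"]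
      by (simp add: d_def algebra_simps)
  qed
  have "d \<longlonglongrightarrow> 2 * (1 - 1) * C"
    unfolding d_def y_def by (intro tendsto_intros sqrt_iter_at_1 LIMSEQ_Suc[OF sqrt_iter_at_1])
  then have "(\<lambda>k. sqrt (1 + d k) * norm x) \<longlonglongrightarrow> sqrt (1 + 2 * (1 - 1) * C) * norm x"
    by (intro tendsto_intros)
  then have "(\<lambda>k. sqrt (1 + d k) * norm x) \<longlonglongrightarrow> norm x" by simp
  then show ?thesis by (rule LIMSEQ_le_const) (use * in blast)
qed

lemma smult_sum_right: "smult r (\<Sum>j\<in>S. f j) = (\<Sum>j\<in>S. smult r (f j))"
  by (induction S rule: infinite_finite_induct) (simp_all add: smult_add_right)

lemma cheb_expansion: "\<exists>c. p = (\<Sum>j\<le>degree p. smult (c j) (cheb j))"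
proof -
  define E where "E = (\<lambda>d (p::real poly). \<exists>c. p = (\<Sum>j\<le>d. smult (c j) (cheb j)))"
  have E_add: "E d (p + q)" if pq: "E d p" "E d q" for d p q
  proof -
    obtain a b where "p = (\<Sum>j\<le>d. smult (a j) (cheb j))" "q = (\<Sum>j\<le>d. smult (b j) (cheb j))"
      using pq unfolding E_def by blast
    then show ?thesis unfolding E_def
      by (intro exI[of _ "\<lambda>j. a j + b j"]) (simp add: smult_add_left sum.distrib)
  qed
  have E_smult: "E d (smult r p)" if ep: "E d p" for d r p
  proof -
    obtain a where "p = (\<Sum>j\<le>d. smult (a j) (cheb j))" using ep by (auto simp: E_def)
    then show ?thesis unfolding E_def
      by (intro exI[of _ "\<lambda>j. r * a j"]) (simp add: smult_sum_right)
  qed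
  have E_cheb: "E d (cheb j)" if "j \<le> d" for d j
  proof -
    have "(\<Sum>k\<le>d. smult (if k = j then 1 else 0) (cheb k)) = (\<Sum>k\<le>d. if k = j then cheb k else 0)"
      by (intro sum.cong) auto
    also have "\<dots> = cheb j" using that by (simp add: sum.delta)
    finally show ?thesis unfolding E_def by (intro exI[of _ "\<lambda>k. if k = j then 1 else 0"]) simp
  qed
  have E_0: "E d 0" for d unfolding E_def by (intro exI[of _ "\<lambda>_. 0"]) simp
  have E_sum: "E d (\<Sum>j\<in>S. f j)" if "\<And>j. j \<in> S \<Longrightarrow> E d (f j)" for d S and f :: "nat \<Rightarrow> real poly"
    using that by (induction S rule: infinite_finite_induct) (auto intro: E_0 E_add)
  have E_X: "E (Suc d) (pCons 0 (cheb j))" if j: "j \<le> d" for d j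
  proof (cases j)
    case 0
    have "pCons 0 (cheb 0) = cheb (Suc 0)" by simp
    then show ?thesis using 0 E_cheb[of "Suc 0" "Suc d"] by simp
  next
    case (Suc k)
    show ?thesis unfolding Suc cheb_Suc_Suc
      using j Suc by (intro E_add E_smult E_cheb) auto
  qed
  have "E (degree p) p"
  proof (induction p)
    case (pCons a p)
    show ?case
    proof (cases "p = 0")
      case True
      have "[:a:] = smult a (cheb 0)" by simp
      then show ?thesis using True E_smult[OF E_cheb[of 0 0], of a] by simp
    next
      case False
      obtain c where c: "p = (\<Sum>j\<le>degree p. smult (c j) (cheb j))"
        using pCons.IH by (auto simp: E_def)
      have "pCons 0 p = [:0, 1:] * p" by simp
      also have "\<dots> = (\<Sum>j\<le>degree p. smult (c j) (pCons 0 (cheb j)))"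
        by (subst c) (simp add: sum_distrib_left)
      finally have X: "pCons 0 p = (\<Sum>j\<le>degree p. smult (c j) (pCons 0 (cheb j)))" .
      have "E (Suc (degree p)) (pCons 0 p)"
        unfolding X by (intro E_sum E_smult E_X) simp
      moreover have "E (Suc (degree p)) (smult a (cheb 0))"
        by (intro E_smult E_cheb) simp
      ultimately have "E (Suc (degree p)) (pCons 0 p + smult a (cheb 0))" by (rule E_add)
      moreover have "pCons 0 p + smult a (cheb 0) = pCons a p" by simp
      ultimately show ?thesis using False by simp
    qed
  qed (rule E_0)
  then show ?thesis by (simp add: E_def)
qed

text \<open>Under \<open>t = cos \<theta>\<close> the expansion becomes a cosine sum, and
  integration against \<open>cos (k \<theta>)\<close> over \<open>[-\<pi>, \<pi>]\<close> isolates
  \<open>c k\<close> with a weight of \<open>\<pi>\<close>, or \<open>2 \<pi>\<close> if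
  \<open>k = 0\<close>. The integrand is at most \<open>M\<close> on a length of
  \<open>2 \<pi>\<close>.\<close>

lemma cheb_coeff_bound:
  assumes p: "p = (\<Sum>j\<le>d. smult (c j) (cheb j))" and M: "\<And>t. \<bar>t\<bar> \<le> 1 \<Longrightarrow> \<bar>poly p t\<bar> \<le> M"
    and k: "k \<le> d"
  shows "\<bar>c k\<bar> \<le> 2 * M"
proof -
  let ?I = "\<lambda>m::int. if m = 0 then 2 * pi else 0 :: real"
  define w where "w = (\<lambda>j. (?I (int j - int k) + ?I (int j + int k)) / 2)"
  have cc: "((\<lambda>t. cos (j * t) * cos (k * t)) has_integral w j) {-pi..pi}" for j :: nat
  proof -
    have "((\<lambda>t. (cos (real_of_int (int j - int k) * t) + cos (real_of_int (int j + int k) * t)) / 2)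
        has_integral w j) {-pi..pi}"
      unfolding w_def by (intro has_integral_divide has_integral_add has_integral_cos_nx)
    moreover have "(cos (real_of_int (int j - int k) * t) + cos (real_of_int (int j + int k) * t)) / 2
        = cos (j * t) * cos (k * t)" for t :: real
      by (simp add: algebra_simps cos_add cos_diff)
    ultimately show ?thesis by simp
  qed
  have "((\<lambda>t. \<Sum>j\<le>d. c j * (cos (j * t) * cos (k * t))) has_integral (\<Sum>j\<le>d. c j * w j)) {-pi..pi}"
    by (intro has_integral_sum has_integral_mult_right cc) auto
  moreover have "(\<Sum>j\<le>d. c j * (cos (j * t) * cos (k * t))) = poly p (cos t) * cos (k * t)" for t :: real
    by (subst p) (simp add: poly_sum poly_cheb_cos sum_distrib_right mult.assoc)
  moreover have "(\<Sum>j\<le>d. c j * w j) = c k * w k"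
  proof -
    have "w j = 0" if "j \<noteq> k" for j using that by (auto simp: w_def)
    then have "(\<Sum>j\<le>d. c j * w j) = (\<Sum>j\<le>d. if j = k then c k * w k else 0)"
      by (intro sum.cong) auto
    then show ?thesis using k by simp
  qed
  ultimately have "((\<lambda>t. poly p (cos t) * cos (k * t)) has_integral c k * w k) (cbox (-pi) pi)"
    by simp
  moreover have "norm (poly p (cos t) * cos (k * t)) \<le> M" for t :: real
  proof -
    have "\<bar>poly p (cos t)\<bar> * \<bar>cos (k * t)\<bar> \<le> M * 1"
      using M[of "cos t"] by (intro mult_mono) auto
    then show ?thesis by (simp add: abs_mult)
  qed
  moreover have "M \<ge> 0" using M[of 0] by simp
  ultimately have "norm (c k * w k) \<le> M * measure lborel (cbox (-pi) pi)"
    by (intro has_integral_bound) auto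
  then have "\<bar>c k\<bar> * \<bar>w k\<bar> \<le> M * (2 * pi)"
    by (simp add: abs_mult)
  moreover have "\<bar>w k\<bar> \<ge> pi" by (auto simp: w_def)
  ultimately have "\<bar>c k\<bar> * pi \<le> (2 * M) * pi"
    using mult_left_mono[of pi "\<bar>w k\<bar>" "\<bar>c k\<bar>"] by linarith
  then show ?thesis by simp
qed

lemma norm_pact_crude:
  fixes h :: "'a::cstar_algebra"
  assumes "adj h = h" "norm h \<le> 1" and M: "\<And>t. \<bar>t\<bar> \<le> 1 \<Longrightarrow> \<bar>poly p t\<bar> \<le> M"
  shows "norm (pact p h x) \<le> 2 * real (degree p + 1) * M * norm x"
proof -
  obtain c where c: "p = (\<Sum>j\<le>degree p. smult (c j) (cheb j))"
    using cheb_expansion by blast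
  have "norm (pact p h x) = norm (\<Sum>j\<le>degree p. c j *\<^sub>R pact (cheb j) h x)"
    by (subst c) (simp add: pact_sum pact_smult)
  also have "\<dots> \<le> (\<Sum>j\<le>degree p. norm (c j *\<^sub>R pact (cheb j) h x))" by (rule norm_sum)
  also have "\<dots> \<le> (\<Sum>j\<le>degree p. 2 * M * norm x)"
  proof (rule sum_mono)
    fix j assume "j \<in> {..degree p}"
    then have "\<bar>c j\<bar> \<le> 2 * M" using cheb_coeff_bound[OF c M] by simp
    then show "norm (c j *\<^sub>R pact (cheb j) h x) \<le> 2 * M * norm x"
      using norm_pact_cheb[OF assms(1,2)] by (auto intro!: mult_mono)
  qed
  also have "\<dots> = 2 * real (degree p + 1) * M * norm x" by (simp add: algebra_simps)
  finally show ?thesis .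
qed

lemma norm_pact_pow2:
  fixes h :: "'a::cstar_algebra"
  assumes "adj h = h"
  shows "norm (pact p h x) ^ (2 ^ n) \<le> norm x ^ (2 ^ n - 1) * norm (pact (p ^ (2 ^ n)) h x)"
proof (induction n)
  case (Suc n)
  let ?N = "2 ^ n :: nat"
  have N: "2 * ?N - 1 = (?N - 1) * 2 + 1" by (cases "?N") auto
  have "norm (pact p h x) ^ (2 * ?N) = (norm (pact p h x) ^ ?N)\<^sup>2"
    by (simp add: power_mult mult.commute[of 2])
  also have "\<dots> \<le> (norm x ^ (?N - 1) * norm (pact (p ^ ?N) h x))\<^sup>2"
    using Suc.IH by (intro power_mono) auto
  also have "\<dots> = norm x ^ ((?N - 1) * 2) * (norm (pact (p ^ ?N) h x))\<^sup>2"
    by (simp add: power_mult_distrib power_mult)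
  also have "\<dots> \<le> norm x ^ ((?N - 1) * 2) * (norm x * norm (pact ((p ^ ?N)\<^sup>2) h x))"
    by (intro mult_left_mono norm_pact_square assms) auto
  also have "\<dots> = norm x ^ (2 * ?N - 1) * norm (pact (p ^ (2 * ?N)) h x)"
    unfolding N by (simp add: power_mult[symmetric] mult.commute[of 2])
  finally show ?case by simp
qed simp

text \<open>Applying the crude bound to the powers \<open>p\<^sup>N\<close> with \<open>N = 2\<^sup>n\<close> makes its linear factor in the degree
  disappear, since \<open>\<parallel>p(h) x\<parallel>\<^sup>N \<le> \<parallel>x\<parallel>\<^bsup>N-1\<^esup> \<parallel>p(h)\<^sup>N x\<parallel>\<close>.\<close>

theorem norm_pact_le:
  fixes h :: "'a::cstar_algebra"
  assumes h: "adj h = h" "norm h \<le> 1" and M: "\<And>t. \<bar>t\<bar> \<le> 1 \<Longrightarrow> \<bar>poly p t\<bar> \<le> M"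
  shows "norm (pact p h x) \<le> M * norm x"
proof (rule ccontr)
  assume "\<not> norm (pact p h x) \<le> M * norm x"
  then have lt: "M * norm x < norm (pact p h x)" by simp
  let ?a = "norm (pact p h x)"
  have "M \<ge> 0" using M[of 0] by simp
  then have a: "?a > 0" using lt by (smt (verit) mult_nonneg_nonneg norm_ge_zero)
  \<comment> \<open>If the claim fails, then \<open>r < 1\<close>, while the crude bound for
    \<open>p^N\<close> with \<open>N = 2^n\<close> gives
    \<open>1 \<le> 2 (degree p * N + 1) r^N\<close>. This is impossible for large
    \<open>N\<close>.\<close>
  define r where "r = M * norm x / ?a"
  have r: "0 \<le> r" "r < 1" using lt a \<open>M \<ge> 0\<close> by (auto simp: r_def)
  have le: "1 \<le> 2 * real (degree p * 2 ^ n + 1) * r ^ (2 ^ n)" for n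
  proof -
    let ?N = "2 ^ n :: nat"
    have "\<bar>poly (p ^ ?N) t\<bar> \<le> M ^ ?N" if "\<bar>t\<bar> \<le> 1" for t
      using M[OF that] by (simp add: poly_power power_abs power_mono)
    then have "norm (pact (p ^ ?N) h x) \<le> 2 * real (degree (p ^ ?N) + 1) * M ^ ?N * norm x"
      by (rule norm_pact_crude[OF h])
    also have "\<dots> \<le> 2 * real (degree p * ?N + 1) * M ^ ?N * norm x"
    proof -
      have "real (degree (p ^ ?N)) \<le> real (degree p * ?N)"
        using degree_power_le[of p ?N] by (simp only: of_nat_le_iff)
      then show ?thesis using \<open>M \<ge> 0\<close> by (intro mult_right_mono) simp_all
    qed
    finally have "norm x ^ (?N - 1) * norm (pact (p ^ ?N) h x)
        \<le> norm x ^ (?N - 1) * (2 * real (degree p * ?N + 1) * M ^ ?N * norm x)"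
      by (intro mult_left_mono) auto
    with norm_pact_pow2[OF h(1), of p x n]
    have "?a ^ ?N \<le> norm x ^ (?N - 1) * (2 * real (degree p * ?N + 1) * M ^ ?N * norm x)" by linarith
    also have "\<dots> = 2 * real (degree p * ?N + 1) * (M ^ ?N * (norm x ^ (?N - 1) * norm x))"
      by (simp add: mult_ac)
    also have "norm x ^ (?N - 1) * norm x = norm x ^ ?N"
      by (rule power_minus_mult) simp
    also have "M ^ ?N * norm x ^ ?N = r ^ ?N * ?a ^ ?N"
      using a by (simp add: r_def power_mult_distrib[symmetric])
    finally have "1 * ?a ^ ?N \<le> (2 * real (degree p * ?N + 1) * r ^ ?N) * ?a ^ ?N"
      by (simp add: mult_ac)
    then show ?thesis using a by (simp only: mult_le_cancel_right_pos zero_less_power)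
  qed
  have "(\<lambda>n. real n * r ^ n) \<longlonglongrightarrow> 0"
    using powser_times_n_limit_0[of r] r by simp
  moreover have "(\<lambda>n. r ^ n) \<longlonglongrightarrow> 0" using r by (simp add: LIMSEQ_realpow_zero)
  ultimately have "(\<lambda>n. 2 * real (degree p) * (real n * r ^ n) + 2 * r ^ n)
      \<longlonglongrightarrow> 2 * real (degree p) * 0 + 2 * 0"
    by (intro tendsto_add tendsto_mult_left)
  then have "(\<lambda>n. 2 * real (degree p) * (real n * r ^ n) + 2 * r ^ n) \<longlonglongrightarrow> 0" by simp
  then have "\<forall>\<^sub>F n in sequentially. 2 * real (degree p) * (real n * r ^ n) + 2 * r ^ n < 1"
    by (rule order_tendstoD) simp
  then obtain N where N: "\<And>n. n \<ge> N \<Longrightarrow> 2 * real (degree p) * (real n * r ^ n) + 2 * r ^ n < 1"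
    by (auto simp: eventually_sequentially)
  have "2 ^ N \<ge> N" using less_exp[of N] by simp
  from N[OF this] le[of N] show False by (simp add: algebra_simps)
qed

section \<open>Continuous functional calculus\<close>

text \<open>The interval contains the spectrum of every self-adjoint contraction, so that spectra
  need not be mentioned. The condition at \<open>0\<close> is what places \<open>f(h)\<close> in an
  algebra without a unit.\<close>

definition C0 :: "(real \<Rightarrow> real) \<Rightarrow> bool"
  where "C0 f \<longleftrightarrow> continuous_on {-1..1} f \<and> f 0 = 0"

lemma C0_bounded: "C0 f \<Longrightarrow> \<exists>M\<ge>0. \<forall>t. \<bar>t\<bar> \<le> 1 \<longrightarrow> \<bar>f t\<bar> \<le> M"
proof -
  assume "C0 f"
  then have "bounded (f ` {-1..1})"
    unfolding C0_def by (intro compact_imp_bounded compact_continuous_image) auto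
  then obtain M where M: "\<forall>t\<in>{-1..1}. \<bar>f t\<bar> \<le> M"
    by (auto simp: bounded_iff)
  then have "M \<ge> 0" by (metis abs_ge_zero atLeastAtMost_iff order_trans zero_le_one neg_le_0_iff_le)
  then show ?thesis using M by (intro exI[of _ M]) (auto simp: abs_le_iff)
qed

lemma C0_intros [intro]:
  "C0 f \<Longrightarrow> C0 g \<Longrightarrow> C0 (\<lambda>t. f t + g t)"
  "C0 f \<Longrightarrow> C0 g \<Longrightarrow> C0 (\<lambda>t. f t - g t)"
  "C0 f \<Longrightarrow> C0 (\<lambda>t. c * f t)"
  "C0 f \<Longrightarrow> C0 g \<Longrightarrow> C0 (\<lambda>t. f t * g t)"
  "C0 (\<lambda>t. t)"
  "C0 (\<lambda>t. 0)"
  by (auto simp: C0_def intro!: continuous_intros)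

lemma C0_sum: "(\<And>i. i \<in> S \<Longrightarrow> C0 (f i)) \<Longrightarrow> C0 (\<lambda>t. \<Sum>i\<in>S. f i t)"
  by (induction S rule: infinite_finite_induct) (auto intro: C0_intros)

lemma C0_approx_poly:
  assumes "C0 f" "\<epsilon> > 0"
  shows "\<exists>p. poly p 0 = 0 \<and> (\<forall>t. \<bar>t\<bar> \<le> 1 \<longrightarrow> \<bar>poly p t - f t\<bar> \<le> \<epsilon>)"
proof -
  obtain g where g: "real_polynomial_function g" "\<And>t. t \<in> {-1..1} \<Longrightarrow> \<bar>f t - g t\<bar> < \<epsilon> / 2"
    using Stone_Weierstrass_real_polynomial_function[of "{-1..1::real}" f "\<epsilon> / 2"] assms
    by (auto simp: C0_def)
  obtain a n where an: "g = (\<lambda>x. \<Sum>i\<le>n. a i * x ^ i)"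
    using g(1) real_polynomial_function_iff_sum by blast
  define q where "q = (\<Sum>i\<le>n. monom (a i) i)"
  have q: "poly q t = g t" for t
    by (simp add: q_def an poly_sum poly_monom)
  \<comment> \<open>Subtracting the constant \<open>g 0\<close> forces the value \<open>0\<close> at
    \<open>0\<close>. It is small because \<open>f 0 = 0\<close>, and costs the other
    \<open>\<epsilon> / 2\<close>.\<close>
  have "\<bar>poly (q - [:g 0:]) t - f t\<bar> \<le> \<epsilon>" if "\<bar>t\<bar> \<le> 1" for t
  proof -
    have "\<bar>f t - g t\<bar> < \<epsilon> / 2" "\<bar>f 0 - g 0\<bar> < \<epsilon> / 2" "f 0 = 0"
      using g(2)[of t] g(2)[of 0] assms(1) that by (auto simp: C0_def abs_le_iff)
    moreover have "poly (q - [:g 0:]) t = g t - g 0" by (simp add: q)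
    ultimately show ?thesis unfolding abs_if by (auto split: if_splits)
  qed
  then show ?thesis by (intro exI[of _ "q - [:g 0:]"]) (simp add: q)
qed

text \<open>Testing on \<open>x = adj a\<close> and using the C*-identity recovers the norm of
  \<open>a\<close> from left multiplication; this replaces evaluation at a unit.\<close>

lemma norm_le_left_mult:
  fixes a :: "'a::cstar_algebra"
  assumes "\<And>x. norm (a * x) \<le> M * norm x" "M \<ge> 0"
  shows "norm a \<le> M"
proof (cases "a = 0")
  case False
  have "norm a * norm a \<le> M * norm a"
    using assms(1)[of "adj a"] by (simp add: norm_mult_adj power2_eq_square)
  then show ?thesis using False by simp
qed (use assms in simp)

text \<open>\<open>fcl h f a\<close> says that left multiplication by \<open>a\<close> is \<open>f(h)\<close>, and \<open>fc h f\<close> is this \<open>a\<close>. It exists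
  if \<open>h\<close> is a self-adjoint contraction and \<open>f\<close> is continuous on \<open>[-1,1]\<close> with \<open>f(0) = 0\<close>.\<close>

definition fcl :: "'a::cstar_algebra \<Rightarrow> (real \<Rightarrow> real) \<Rightarrow> 'a \<Rightarrow> bool"
  where "fcl h f a \<longleftrightarrow> (\<forall>\<epsilon>>0. \<exists>p. (\<forall>t. \<bar>t\<bar> \<le> 1 \<longrightarrow> \<bar>poly p t - f t\<bar> \<le> \<epsilon>) \<and>
    (\<forall>x. norm (pact p h x - a * x) \<le> \<epsilon> * norm x))"

lemma fclD:
  assumes "fcl h f a" "\<epsilon> > 0"
  obtains p where "\<And>t. \<bar>t\<bar> \<le> 1 \<Longrightarrow> \<bar>poly p t - f t\<bar> \<le> \<epsilon>"
    "\<And>x. norm (pact p h x - a * x) \<le> \<epsilon> * norm x"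
  using assms unfolding fcl_def by blast

definition fc :: "'a::cstar_algebra \<Rightarrow> (real \<Rightarrow> real) \<Rightarrow> 'a"
  where "fc h f = (SOME a. fcl h f a)"

lemma fc_cong: "(\<And>t. \<bar>t\<bar> \<le> 1 \<Longrightarrow> f t = g t) \<Longrightarrow> fc h f = fc h g"
proof -
  assume *: "\<And>t. \<bar>t\<bar> \<le> 1 \<Longrightarrow> f t = g t"
  have "fcl h f = fcl h g" unfolding fcl_def using * by (intro ext) (simp cong: conj_cong)
  then show ?thesis by (simp add: fc_def)
qed

locale sa_contraction =
  fixes h :: "'a::cstar_algebra"
  assumes sa: "adj h = h" and contr: "norm h \<le> 1"
begin

text \<open>The constant \<open>c\<close> makes formal elements \<open>c - f(h)\<close> available as
  operators: \<open>c = 0\<close> yields the norm bound for \<open>f(h)\<close>, and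
  \<open>c = 1\<close> the contractivity of \<open>1 - f(h)\<close>.\<close>

lemma fcl_scaleR_diff:
  assumes "fcl h f a" and M: "\<And>t. \<bar>t\<bar> \<le> 1 \<Longrightarrow> \<bar>c - f t\<bar> \<le> M"
  shows "norm (c *\<^sub>R x - a * x) \<le> M * norm x"
proof (rule field_le_epsilon)
  fix e :: real assume "e > 0"
  define \<epsilon> where "\<epsilon> = e / (2 * norm x + 1)"
  have "\<epsilon> > 0" unfolding \<epsilon>_def using \<open>e > 0\<close> by (intro divide_pos_pos) (auto intro: add_nonneg_pos)
  have \<epsilon>: "2 * \<epsilon> * norm x \<le> e"
  proof -
    have "2 * norm x + 1 > 0" using norm_ge_zero[of x] by linarith
    then have "\<epsilon> * (2 * norm x + 1) = e" by (simp add: \<epsilon>_def)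
    then show ?thesis using \<open>\<epsilon> > 0\<close> by (simp add: algebra_simps)
  qed
  obtain p where p: "\<And>t. \<bar>t\<bar> \<le> 1 \<Longrightarrow> \<bar>poly p t - f t\<bar> \<le> \<epsilon>"
    "\<And>x. norm (pact p h x - a * x) \<le> \<epsilon> * norm x"
    using fclD[OF assms(1) \<open>\<epsilon> > 0\<close>] by blast
  have "\<bar>poly ([:c:] - p) t\<bar> \<le> M + \<epsilon>" if "\<bar>t\<bar> \<le> 1" for t
    using p(1)[OF that] M[OF that] by simp
  then have "norm (pact ([:c:] - p) h x) \<le> (M + \<epsilon>) * norm x"
    by (rule norm_pact_le[OF sa contr])
  moreover have "c *\<^sub>R x - a * x = pact ([:c:] - p) h x + (pact p h x - a * x)"
    by (simp add: pact_diff)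
  ultimately have "norm (c *\<^sub>R x - a * x) \<le> (M + \<epsilon>) * norm x + \<epsilon> * norm x"
    using p(2)[of x] norm_triangle_mono by metis
  then show "norm (c *\<^sub>R x - a * x) \<le> M * norm x + e" using \<epsilon> by (simp add: algebra_simps)
qed

lemma fcl_norm:
  assumes "fcl h f a" and M: "\<And>t. \<bar>t\<bar> \<le> 1 \<Longrightarrow> \<bar>f t\<bar> \<le> M"
  shows "norm a \<le> M"
proof (rule norm_le_left_mult)
  show "norm (a * x) \<le> M * norm x" for x
    using fcl_scaleR_diff[OF assms(1), of 0 M x] M by simp
  show "M \<ge> 0" using M[of 0] by simp
qed

lemma fcl_lin:
  assumes "fcl h f a" "fcl h g b"
  shows "fcl h (\<lambda>t. r * f t + s * g t) (r *\<^sub>R a + s *\<^sub>R b)"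
  unfolding fcl_def
proof (intro allI impI)
  fix e :: real assume "e > 0"
  define \<epsilon> where "\<epsilon> = e / (\<bar>r\<bar> + \<bar>s\<bar> + 1)"
  have "\<epsilon> > 0" unfolding \<epsilon>_def using \<open>e > 0\<close> by (intro divide_pos_pos) auto
  have \<epsilon>: "\<bar>r\<bar> * \<epsilon> + \<bar>s\<bar> * \<epsilon> \<le> e"
  proof -
    have "\<bar>r\<bar> + \<bar>s\<bar> + 1 > 0" by linarith
    then have "\<epsilon> * (\<bar>r\<bar> + \<bar>s\<bar> + 1) = e" by (simp add: \<epsilon>_def)
    then show ?thesis using \<open>\<epsilon> > 0\<close> by (simp add: algebra_simps)
  qed
  obtain p where p: "\<And>t. \<bar>t\<bar> \<le> 1 \<Longrightarrow> \<bar>poly p t - f t\<bar> \<le> \<epsilon>"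
    "\<And>x. norm (pact p h x - a * x) \<le> \<epsilon> * norm x"
    using fclD[OF assms(1) \<open>\<epsilon> > 0\<close>] by blast
  obtain q where q: "\<And>t. \<bar>t\<bar> \<le> 1 \<Longrightarrow> \<bar>poly q t - g t\<bar> \<le> \<epsilon>"
    "\<And>x. norm (pact q h x - b * x) \<le> \<epsilon> * norm x"
    using fclD[OF assms(2) \<open>\<epsilon> > 0\<close>] by blast
  show "\<exists>p. (\<forall>t. \<bar>t\<bar> \<le> 1 \<longrightarrow> \<bar>poly p t - (r * f t + s * g t)\<bar> \<le> e) \<and>
      (\<forall>x. norm (pact p h x - (r *\<^sub>R a + s *\<^sub>R b) * x) \<le> e * norm x)"
  proof (intro exI conjI allI impI)
    fix t :: real assume t: "\<bar>t\<bar> \<le> 1"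
    have "\<bar>r * (poly p t - f t) + s * (poly q t - g t)\<bar>
        \<le> \<bar>r\<bar> * \<bar>poly p t - f t\<bar> + \<bar>s\<bar> * \<bar>poly q t - g t\<bar>"
      by (metis abs_mult abs_triangle_ineq)
    also have "\<dots> \<le> \<bar>r\<bar> * \<epsilon> + \<bar>s\<bar> * \<epsilon>"
      by (intro add_mono mult_left_mono p q t) auto
    finally show "\<bar>poly (smult r p + smult s q) t - (r * f t + s * g t)\<bar> \<le> e"
      using \<epsilon> by (simp add: algebra_simps)
  next
    fix x
    have "pact (smult r p + smult s q) h x - (r *\<^sub>R a + s *\<^sub>R b) * x
        = r *\<^sub>R (pact p h x - a * x) + s *\<^sub>R (pact q h x - b * x)"
      by (simp add: pact_add pact_smult algebra_simps)
    also have "norm \<dots> \<le> \<bar>r\<bar> * norm (pact p h x - a * x) + \<bar>s\<bar> * norm (pact q h x - b * x)"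
      by (rule order_trans[OF norm_triangle_ineq]) simp
    also have "\<dots> \<le> \<bar>r\<bar> * (\<epsilon> * norm x) + \<bar>s\<bar> * (\<epsilon> * norm x)"
      by (intro add_mono mult_left_mono p q) auto
    also have "\<dots> = (\<bar>r\<bar> * \<epsilon> + \<bar>s\<bar> * \<epsilon>) * norm x" by (simp add: algebra_simps)
    also have "\<dots> \<le> e * norm x" by (intro mult_right_mono \<epsilon>) auto
    finally show "norm (pact (smult r p + smult s q) h x - (r *\<^sub>R a + s *\<^sub>R b) * x) \<le> e * norm x" .
  qed
qed

lemma fcl_mult:
  assumes "fcl h f a" "fcl h g b" "C0 f" "C0 g"
  shows "fcl h (\<lambda>t. f t * g t) (a * b)"
  unfolding fcl_def
proof (intro allI impI)
  fix e :: real assume "e > 0"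
  obtain M where M: "M \<ge> 0" "\<And>t. \<bar>t\<bar> \<le> 1 \<Longrightarrow> \<bar>f t\<bar> \<le> M" using C0_bounded[OF assms(3)] by blast
  obtain N where N: "N \<ge> 0" "\<And>t. \<bar>t\<bar> \<le> 1 \<Longrightarrow> \<bar>g t\<bar> \<le> N" using C0_bounded[OF assms(4)] by blast
  \<comment> \<open>The cap at \<open>1\<close> keeps the approximant \<open>p\<close> of
    \<open>f\<close> below \<open>M + 1\<close> on the interval.\<close>
  define \<epsilon> where "\<epsilon> = min 1 (e / (M + N + norm b + 1))"
  have den: "M + N + norm b + 1 > 0" using M N by (simp add: add_nonneg_pos)
  have "\<epsilon> > 0" unfolding \<epsilon>_def using \<open>e > 0\<close> den by simp
  have "\<epsilon> * (M + N + norm b + 1) \<le> e"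
    using den by (metis \<epsilon>_def min.cobounded2 pos_le_divide_eq)
  then have \<epsilon>: "(M + 1) * \<epsilon> + \<epsilon> * N + \<epsilon> * norm b \<le> e" by (simp add: algebra_simps)
  have "\<epsilon> \<le> 1" by (simp add: \<epsilon>_def)
  obtain p where p: "\<And>t. \<bar>t\<bar> \<le> 1 \<Longrightarrow> \<bar>poly p t - f t\<bar> \<le> \<epsilon>"
    "\<And>x. norm (pact p h x - a * x) \<le> \<epsilon> * norm x"
    using fclD[OF assms(1) \<open>\<epsilon> > 0\<close>] by blast
  obtain q where q: "\<And>t. \<bar>t\<bar> \<le> 1 \<Longrightarrow> \<bar>poly q t - g t\<bar> \<le> \<epsilon>"
    "\<And>x. norm (pact q h x - b * x) \<le> \<epsilon> * norm x"
    using fclD[OF assms(2) \<open>\<epsilon> > 0\<close>] by blast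
  have pM: "\<bar>poly p t\<bar> \<le> M + 1" if "\<bar>t\<bar> \<le> 1" for t
    using p(1)[OF that] M(2)[OF that] \<open>\<epsilon> \<le> 1\<close> by linarith
  show "\<exists>p. (\<forall>t. \<bar>t\<bar> \<le> 1 \<longrightarrow> \<bar>poly p t - f t * g t\<bar> \<le> e) \<and>
      (\<forall>x. norm (pact p h x - a * b * x) \<le> e * norm x)"
  proof (intro exI conjI allI impI)
    fix t :: real assume t: "\<bar>t\<bar> \<le> 1"
    have "poly (p * q) t - f t * g t = poly p t * (poly q t - g t) + (poly p t - f t) * g t"
      by (simp add: algebra_simps)
    also have "\<bar>\<dots>\<bar> \<le> \<bar>poly p t\<bar> * \<bar>poly q t - g t\<bar> + \<bar>poly p t - f t\<bar> * \<bar>g t\<bar>"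
      by (metis abs_mult abs_triangle_ineq)
    also have "\<dots> \<le> (M + 1) * \<epsilon> + \<epsilon> * N"
      using M(1) N(1) \<open>\<epsilon> > 0\<close> by (intro add_mono mult_mono p q pM t N(2)) auto
    also have "\<dots> \<le> e" using \<epsilon> \<open>\<epsilon> > 0\<close> by (smt (verit) mult_nonneg_nonneg norm_ge_zero)
    finally show "\<bar>poly (p * q) t - f t * g t\<bar> \<le> e" .
  next
    fix x
    have "pact (p * q) h x - a * b * x = pact p h (pact q h x - b * x) + (pact p h (b * x) - a * (b * x))"
      by (simp add: pact_mult pact_diff_right mult.assoc)
    also have "norm \<dots> \<le> (M + 1) * norm (pact q h x - b * x) + \<epsilon> * norm (b * x)"
      by (intro norm_triangle_mono norm_pact_le[OF sa contr] pM p(2))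
    also have "\<dots> \<le> (M + 1) * (\<epsilon> * norm x) + \<epsilon> * (norm b * norm x)"
      using M \<open>\<epsilon> > 0\<close> by (intro add_mono mult_left_mono q norm_mult_ineq) auto
    also have "\<dots> = ((M + 1) * \<epsilon> + \<epsilon> * norm b) * norm x" by (simp add: algebra_simps)
    also have "\<dots> \<le> e * norm x"
      using \<epsilon> \<open>\<epsilon> > 0\<close> N by (intro mult_right_mono) (smt (verit) mult_nonneg_nonneg, simp)
    finally show "norm (pact (p * q) h x - a * b * x) \<le> e * norm x" .
  qed
qed

text \<open>Approximation by polynomials makes \<open>adj x * (adj a * y - a * y)\<close>
  arbitrarily small. With the bracket itself for \<open>x\<close>, the C*-identity kills the
  bracket, and \<open>y\<close> is then removed by \<open>norm_le_left_mult\<close>.\<close>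

lemma fcl_sa:
  assumes "fcl h f a"
  shows "adj a = a"
proof -
  have zero: "adj x * (adj a * y - a * y) = 0" for x y
  proof -
    have "norm (adj x * (adj a * y - a * y)) \<le> 0 + e" if "e > 0" for e
    proof -
      define \<epsilon> where "\<epsilon> = e / (2 * (norm x * norm y) + 1)"
      have den: "2 * (norm x * norm y) + 1 > 0" by (simp add: add_nonneg_pos)
      then have "\<epsilon> > 0" "\<epsilon> * (2 * (norm x * norm y) + 1) = e" using that by (simp_all add: \<epsilon>_def)
      then have \<epsilon>: "2 * \<epsilon> * (norm x * norm y) \<le> e" by (simp add: algebra_simps)
      obtain p where "\<And>t. \<bar>t\<bar> \<le> 1 \<Longrightarrow> \<bar>poly p t - f t\<bar> \<le> \<epsilon>"
        and p: "\<And>x. norm (pact p h x - a * x) \<le> \<epsilon> * norm x"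
        using fclD[OF assms \<open>\<epsilon> > 0\<close>] by blast
      have "adj x * (adj a * y - a * y)
          = adj x * (pact p h y - a * y) - adj (pact p h x - a * x) * y"
        by (simp add: adj_diff adj_mult left_diff_distrib right_diff_distrib adj_pact_mult[OF sa] mult.assoc)
      also have "norm \<dots> \<le> norm (adj x * (pact p h y - a * y)) + norm (adj (pact p h x - a * x) * y)"
        by (rule norm_triangle_ineq4)
      also have "\<dots> \<le> norm x * (\<epsilon> * norm y) + (\<epsilon> * norm x) * norm y"
        using p \<open>\<epsilon> > 0\<close> by (intro add_mono order_trans[OF norm_mult_ineq] mult_mono) auto
      also have "\<dots> \<le> e" using \<epsilon> by (simp add: algebra_simps)
      finally show ?thesis by simp
    qed
    then have "norm (adj x * (adj a * y - a * y)) \<le> 0" by (rule field_le_epsilon)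
    then show ?thesis by simp
  qed
  have "adj a * y - a * y = 0" for y
    using zero[of "adj a * y - a * y" y] cstar_identity[of "adj a * y - a * y"] by simp
  then have "norm ((adj a - a) * y) \<le> 0 * norm y" for y
    by (simp add: left_diff_distrib)
  then have "norm (adj a - a) \<le> 0" by (rule norm_le_left_mult) simp
  then show ?thesis by simp
qed

lemma fcl_id: "fcl h (\<lambda>t. t) h"
  unfolding fcl_def by (intro allI impI exI[of _ "[:0, 1:]"]) simp

lemma pact_as_mult: "poly p 0 = 0 \<Longrightarrow> \<exists>a. \<forall>x. pact p h x = a * x"
  by (cases p) (auto simp: pact_times pact_commute intro!: exI[of _ "pact _ h h"])

lemma fcl_ex:
  assumes "C0 f"
  shows "\<exists>a. fcl h f a"
proof -
  have "\<forall>n. \<exists>p. poly p 0 = 0 \<and> (\<forall>t. \<bar>t\<bar> \<le> 1 \<longrightarrow> \<bar>poly p t - f t\<bar> \<le> 1 / real (Suc n))"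
    using C0_approx_poly[OF assms] by simp
  then obtain p where p0: "\<And>n. poly (p n) 0 = 0"
    and p: "\<And>n t. \<bar>t\<bar> \<le> 1 \<Longrightarrow> \<bar>poly (p n) t - f t\<bar> \<le> 1 / real (Suc n)" by metis
  have "\<forall>n. \<exists>a. \<forall>x. pact (p n) h x = a * x" using pact_as_mult p0 by blast
  then obtain a where a: "\<And>n x. pact (p n) h x = a n * x" by metis
  have dist: "norm (a m - a n) \<le> 1 / real (Suc m) + 1 / real (Suc n)" for m n
  proof (rule norm_le_left_mult)
    fix x
    have "\<bar>poly (p m - p n) t\<bar> \<le> 1 / real (Suc m) + 1 / real (Suc n)" if "\<bar>t\<bar> \<le> 1" for t
      using p[OF that, of m] p[OF that, of n] by simp
    then have "norm (pact (p m - p n) h x) \<le> (1 / real (Suc m) + 1 / real (Suc n)) * norm x"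
      by (rule norm_pact_le[OF sa contr])
    then show "norm ((a m - a n) * x) \<le> (1 / real (Suc m) + 1 / real (Suc n)) * norm x"
      by (simp add: pact_diff a left_diff_distrib)
  qed simp
  have small: "\<exists>N. \<forall>n\<ge>N. 1 / real (Suc n) < e" if "e > 0" for e :: real
  proof -
    have "(\<lambda>n. 1 / real (Suc n)) \<longlonglongrightarrow> 0"
      using LIMSEQ_inverse_real_of_nat by (simp add: inverse_eq_divide)
    from order_tendstoD(2)[OF this \<open>e > 0\<close>] show ?thesis
      by (simp add: eventually_sequentially)
  qed
  have "Cauchy a"
  proof (rule metric_CauchyI)
    fix e :: real assume "e > 0"
    then obtain N where N: "\<forall>n\<ge>N. 1 / real (Suc n) < e / 2" using small[of "e / 2"] by auto
    have "dist (a m) (a n) < e" if "m \<ge> N" "n \<ge> N" for m n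
      using dist[of m n] N[rule_format, OF that(1)] N[rule_format, OF that(2)]
      unfolding dist_norm by linarith
    then show "\<exists>N. \<forall>m\<ge>N. \<forall>n\<ge>N. dist (a m) (a n) < e" by blast
  qed
  then obtain l where l: "a \<longlonglongrightarrow> l" using Cauchy_convergent_iff convergent_def by blast
  have "fcl h f l"
    unfolding fcl_def
  proof (intro allI impI)
    fix e :: real assume "e > 0"
    obtain N where N: "\<forall>n\<ge>N. 1 / real (Suc n) < e" using small[OF \<open>e > 0\<close>] by blast
    obtain N' where N': "\<forall>n\<ge>N'. norm (a n - l) < e"
      using LIMSEQ_D[OF l \<open>e > 0\<close>] by blast
    let ?n = "max N N'"
    show "\<exists>p. (\<forall>t. \<bar>t\<bar> \<le> 1 \<longrightarrow> \<bar>poly p t - f t\<bar> \<le> e) \<and>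
      (\<forall>x. norm (pact p h x - l * x) \<le> e * norm x)"
    proof (intro exI conjI allI impI)
      fix t :: real assume "\<bar>t\<bar> \<le> 1"
      then show "\<bar>poly (p ?n) t - f t\<bar> \<le> e"
        using p[of t ?n] N[rule_format, of ?n] by simp
    next
      fix x
      have "norm ((a ?n - l) * x) \<le> norm (a ?n - l) * norm x" by (rule norm_mult_ineq)
      also have "\<dots> \<le> e * norm x"
        using N'[rule_format, of ?n] by (intro mult_right_mono) auto
      finally show "norm (pact (p ?n) h x - l * x) \<le> e * norm x"
        by (simp add: a left_diff_distrib)
    qed
  qed
  then show ?thesis by blast
qed

lemma fcl_unique:
  assumes "fcl h f a" "fcl h f b"
  shows "a = b"
proof -
  have "norm (1 *\<^sub>R a + (-1) *\<^sub>R b) \<le> 0"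
    using fcl_norm[OF fcl_lin[OF assms, of 1 "-1"], of 0] by simp
  then show ?thesis by simp
qed

lemma fcl_fc: "C0 f \<Longrightarrow> fcl h f (fc h f)"
  unfolding fc_def using fcl_ex by (rule someI_ex)

lemma fc_sa: "C0 f \<Longrightarrow> adj (fc h f) = fc h f"
  by (rule fcl_sa[OF fcl_fc])

lemma fc_eqI: "fcl h f a \<Longrightarrow> fc h f = a"
  unfolding fc_def using fcl_unique by (blast intro: some_equality)

lemma fc_id: "fc h (\<lambda>t. t) = h"
  by (intro fc_eqI fcl_id)

lemma fc_mult: "C0 f \<Longrightarrow> C0 g \<Longrightarrow> fc h (\<lambda>t. f t * g t) = fc h f * fc h g"
  by (intro fc_eqI fcl_mult fcl_fc)

lemma fc_lin: "C0 f \<Longrightarrow> C0 g \<Longrightarrow> fc h (\<lambda>t. r * f t + s * g t) = r *\<^sub>R fc h f + s *\<^sub>R fc h g"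
  by (intro fc_eqI fcl_lin fcl_fc)

lemma fc_add: "C0 f \<Longrightarrow> C0 g \<Longrightarrow> fc h (\<lambda>t. f t + g t) = fc h f + fc h g"
  using fc_lin[of f g 1 1] by simp

lemma fc_diff: "C0 f \<Longrightarrow> C0 g \<Longrightarrow> fc h (\<lambda>t. f t - g t) = fc h f - fc h g"
  using fc_lin[of f g 1 "-1"] by simp

lemma fc_scale: "C0 f \<Longrightarrow> fc h (\<lambda>t. r * f t) = r *\<^sub>R fc h f"
  using fc_lin[of f f r 0] by simp

lemma fc_0: "fc h (\<lambda>t. 0) = 0"
  using fc_scale[of "\<lambda>t. 0" 0] by auto

lemma fc_sum: "(\<And>i. i \<in> S \<Longrightarrow> C0 (f i)) \<Longrightarrow> fc h (\<lambda>t. \<Sum>i\<in>S. f i t) = (\<Sum>i\<in>S. fc h (f i))"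
  by (induction S rule: infinite_finite_induct) (auto simp: fc_0 fc_add C0_sum)

lemma fc_commute: "C0 f \<Longrightarrow> C0 g \<Longrightarrow> fc h f * fc h g = fc h g * fc h f"
  by (simp flip: fc_mult add: mult.commute)

lemma fc_norm: "C0 f \<Longrightarrow> (\<And>t. \<bar>t\<bar> \<le> 1 \<Longrightarrow> \<bar>f t\<bar> \<le> M) \<Longrightarrow> norm (fc h f) \<le> M"
  by (rule fcl_norm[OF fcl_fc])

lemma norm_diff_fc_mult:
  "C0 f \<Longrightarrow> (\<And>t. \<bar>t\<bar> \<le> 1 \<Longrightarrow> \<bar>1 - f t\<bar> \<le> 1) \<Longrightarrow> norm (x - fc h f * x) \<le> norm x"
  using fcl_scaleR_diff[OF fcl_fc, of f 1 1 x] by simp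

end

section \<open>Approximate units of a C*-algebra\<close>

definition cutoff :: "real \<Rightarrow> real \<Rightarrow> real"
  where "cutoff \<delta> t = min 1 (\<bar>t\<bar> / \<delta>)"

lemma C0_cutoff: "\<delta> > 0 \<Longrightarrow> C0 (cutoff \<delta>)"
  unfolding C0_def cutoff_def by (auto intro!: continuous_intros)

lemma cutoff_bounds: "\<delta> > 0 \<Longrightarrow> 0 \<le> cutoff \<delta> t \<and> cutoff \<delta> t \<le> 1"
  by (simp add: cutoff_def)

text \<open>No order theory is needed for approximate units: products of the formal elements \<open>1 - g\<close>, which
  act as contractions, treat finitely many elements one after the other.\<close>

lemma left_unit_single:
  fixes b :: "'a::cstar_algebra"
  assumes "\<epsilon> > 0"
  shows "\<exists>g. (\<forall>x. norm (x - g * x) \<le> norm x) \<and> norm (b - g * b) \<le> \<epsilon>"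
proof -
  define h0 where "h0 = b * adj b"
  define s where "s = 1 + norm h0"
  define h where "h = (1 / s) *\<^sub>R h0"
  have s: "s > 0" "norm h0 \<le> s" by (auto simp: s_def add_pos_nonneg)
  interpret sa_contraction h
  proof
    show "adj h = h" by (simp add: h_def h0_def adj_scaleR adj_mult adj_adj)
    show "norm h \<le> 1" using s by (simp add: h_def)
  qed
  \<comment> \<open>Chosen so that \<open>2 s \<delta> = \<epsilon>^2\<close>, the final bound for
    the square of \<open>norm (b - g * b)\<close>.\<close>
  define \<delta> where "\<delta> = \<epsilon>\<^sup>2 / (2 * s)"
  have \<delta>: "\<delta> > 0" using s assms by (simp add: \<delta>_def)
  let ?c = "cutoff \<delta>"
  define g where "g = fc h ?c"
  note C = C0_cutoff[OF \<delta>]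
  have "\<bar>t - ?c t * t\<bar> \<le> \<delta>" for t
  proof (cases "\<bar>t\<bar> \<le> \<delta>")
    case True
    have "\<bar>t - ?c t * t\<bar> = \<bar>1 - ?c t\<bar> * \<bar>t\<bar>" by (simp add: abs_mult[symmetric] algebra_simps)
    also have "\<dots> \<le> 1 * \<delta>" using cutoff_bounds[OF \<delta>, of t] True by (intro mult_mono) auto
    finally show ?thesis by simp
  next
    case False
    then have "?c t = 1" using \<delta> by (simp add: cutoff_def)
    then show ?thesis using \<delta> by simp
  qed
  then have "norm (fc h (\<lambda>t. t - ?c t * t)) \<le> \<delta>"
    by (intro fc_norm C0_intros C)
  moreover have "fc h (\<lambda>t. t - ?c t * t) = h - g * h"
    using C by (simp add: fc_diff fc_mult C0_intros fc_id g_def)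
  ultimately have "norm (h - g * h) \<le> \<delta>" by simp
  moreover have "h0 - g * h0 = s *\<^sub>R (h - g * h)"
    using s by (simp add: h_def scaleR_diff_right)
  ultimately have d0: "norm (h0 - g * h0) \<le> s * \<delta>" using s by simp
  have ng: "norm g \<le> 1"
    unfolding g_def using cutoff_bounds[OF \<delta>] by (intro fc_norm C) (auto simp: abs_le_iff)
  let ?y = "b - g * b"
  \<comment> \<open>This is \<open>(1 - g) h0 (1 - adj g)\<close> written without a unit: the claim
    about \<open>b\<close> is reduced to one about the self-adjoint \<open>h0\<close>.\<close>
  have "?y * adj ?y = (h0 - g * h0) - (h0 - g * h0) * adj g"
    by (simp add: h0_def adj_diff adj_mult algebra_simps)
  then have "(norm ?y)\<^sup>2 \<le> norm (h0 - g * h0) + norm ((h0 - g * h0) * adj g)"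
    by (metis norm_mult_adj norm_triangle_ineq4)
  also have "\<dots> \<le> norm (h0 - g * h0) + norm (h0 - g * h0) * 1"
    using ng by (intro add_mono order_trans[OF norm_mult_ineq] mult_left_mono) auto
  also have "\<dots> \<le> 2 * (s * \<delta>)" using d0 by simp
  also have "\<dots> = \<epsilon>\<^sup>2" using s(1) by (simp add: \<delta>_def)
  finally have "norm ?y \<le> \<epsilon>" by (rule power2_le_imp_le) (use assms in simp)
  moreover have "norm (x - g * x) \<le> norm x" for x
    unfolding g_def using cutoff_bounds[OF \<delta>] by (intro norm_diff_fc_mult C) (auto simp: abs_le_iff)
  ultimately show ?thesis by blast
qed

lemma left_unit_finite:
  fixes S :: "'a::cstar_algebra set"
  assumes "finite S" "\<epsilon> > 0"
  shows "\<exists>u. (\<forall>x. norm (x - u * x) \<le> norm x) \<and> (\<forall>a\<in>S. norm (a - u * a) \<le> \<epsilon>)"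
  using assms(1)
proof (induction S)
  case empty
  show ?case by (intro exI[of _ 0]) simp
next
  case (insert a S)
  then obtain u where u: "\<And>x. norm (x - u * x) \<le> norm x" "\<And>a. a \<in> S \<Longrightarrow> norm (a - u * a) \<le> \<epsilon>" by blast
  obtain g where g: "\<And>x. norm (x - g * x) \<le> norm x" "norm ((a - u * a) - g * (a - u * a)) \<le> \<epsilon>"
    using left_unit_single[OF assms(2), of "a - u * a"] by blast
  \<comment> \<open>Formally \<open>1 - w = (1 - g) (1 - u)\<close>. Since \<open>1 - g\<close> acts
    as a contraction, what \<open>u\<close> achieved on \<open>S\<close> is kept.\<close>
  let ?w = "u + g - g * u"
  have w: "x - ?w * x = (x - u * x) - g * (x - u * x)" for x
    by (simp add: algebra_simps)
  have "norm (x - ?w * x) \<le> norm (x - u * x)" for x unfolding w by (rule g)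
  then show ?case
    using u g(2) by (intro exI[of _ ?w]) (auto simp: w[of a] intro: order_trans)
qed

lemma norm_left_unit_contraction:
  fixes u :: "'a::cstar_algebra"
  assumes "\<And>x. norm (x - u * x) \<le> norm x"
  shows "norm u \<le> 2"
proof (rule norm_le_left_mult)
  fix x
  have "norm (u * x) \<le> norm x + norm (x - u * x)"
    using norm_triangle_ineq4[of x "x - u * x"] by simp
  then show "norm (u * x) \<le> 2 * norm x" using assms[of x] by simp
qed simp

text \<open>The bound \<open>8\<close> is \<open>2 + 2 + 4\<close>, coming from elements
  \<open>u + v - v * u\<close> with \<open>u\<close> and \<open>v\<close> of norm at most
  \<open>2\<close>.\<close>

definition local_units :: "'a::cstar_algebra set \<Rightarrow> real \<Rightarrow> 'a set"
  where "local_units S \<epsilon> = {w. norm w \<le> 8 \<and> (\<forall>a\<in>S. norm (a - w * a) \<le> \<epsilon> \<and> norm (a - a * w) \<le> \<epsilon>)}"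

lemma local_units_nonempty:
  fixes S :: "'a::cstar_algebra set"
  assumes "finite S" "\<epsilon> > 0"
  shows "local_units S \<epsilon> \<noteq> {}"
proof -
  obtain u where u: "\<And>x. norm (x - u * x) \<le> norm x" "\<And>a. a \<in> S \<Longrightarrow> norm (a - u * a) \<le> \<epsilon> / 3"
    using left_unit_finite[of S "\<epsilon> / 3"] assms by auto
  obtain v where v: "\<And>x. norm (x - v * x) \<le> norm x" "\<And>a. a \<in> S \<Longrightarrow> norm (adj a - v * adj a) \<le> \<epsilon> / 3"
    using left_unit_finite[of "adj ` S" "\<epsilon> / 3"] assms by auto
  \<comment> \<open>Formally \<open>1 - w = (1 - adj v) (1 - u)\<close>: the right factor makes
    \<open>w\<close> a left unit, the left factor a right unit. Each factor has norm at most
    \<open>1 + 2\<close>, hence the tolerance \<open>\<epsilon> / 3\<close>.\<close>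
  let ?v = "adj v" and ?w = "u + adj v - adj v * u"
  have nu: "norm u \<le> 2" and nv: "norm ?v \<le> 2"
    using norm_left_unit_contraction[of u] norm_left_unit_contraction[of v] u v by auto
  have "norm (?v * u) \<le> 2 * 2"
    by (rule order_trans[OF norm_mult_ineq]) (intro mult_mono nu nv; simp)
  then have "norm ?w \<le> 8"
    using nu nv norm_triangle_ineq4[of "u + ?v" "?v * u"] norm_triangle_ineq[of u ?v] by linarith
  moreover have "norm (a - ?w * a) \<le> \<epsilon>" if "a \<in> S" for a
  proof -
    have eq: "a - ?w * a = (a - u * a) - ?v * (a - u * a)" by (simp add: algebra_simps)
    have "norm (?v * (a - u * a)) \<le> 2 * (\<epsilon> / 3)"
      by (rule order_trans[OF norm_mult_ineq]) (intro mult_mono nv u(2) that; simp)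
    then show ?thesis unfolding eq
      using u(2)[OF that] norm_triangle_ineq4[of "a - u * a" "?v * (a - u * a)"] by linarith
  qed
  moreover have "norm (a - a * ?w) \<le> \<epsilon>" if "a \<in> S" for a
  proof -
    have "norm (a - a * ?v) = norm (adj (a - a * ?v))" by simp
    also have "\<dots> \<le> \<epsilon> / 3" using v(2)[OF that] by (simp only: adj_diff adj_mult adj_adj)
    finally have *: "norm (a - a * ?v) \<le> \<epsilon> / 3" .
    have eq: "a - a * ?w = (a - a * ?v) - (a - a * ?v) * u" by (simp add: algebra_simps)
    have "norm ((a - a * ?v) * u) \<le> (\<epsilon> / 3) * 2"
      by (rule order_trans[OF norm_mult_ineq]) (intro mult_mono nu *; use assms in simp)
    then show ?thesis unfolding eq
      using * norm_triangle_ineq4[of "a - a * ?v" "(a - a * ?v) * u"] by linarith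
  qed
  ultimately show ?thesis by (auto simp: local_units_def)
qed

text \<open>A filter in place of a net: it needs no choice of one unit for each finite set and
  tolerance, and every limit along it is an ordinary filter limit.\<close>

definition approx_unit :: "'a::cstar_algebra filter"
  where "approx_unit = (INF (S, \<epsilon>) \<in> {(S, \<epsilon>). finite S \<and> \<epsilon> > 0}. principal (local_units S \<epsilon>))"

lemma eventually_approx_unit:
  "eventually P (approx_unit :: 'a::cstar_algebra filter) \<longleftrightarrow>
    (\<exists>S \<epsilon>. finite S \<and> \<epsilon> > 0 \<and> (\<forall>w\<in>local_units S \<epsilon>. P w))"
proof -
  let ?B = "{(S, \<epsilon>). finite S \<and> \<epsilon> > 0} :: ('a set \<times> real) set"
  have "eventually P approx_unit \<longleftrightarrow> (\<exists>i\<in>?B. eventually P (case i of (S, \<epsilon>) \<Rightarrow> principal (local_units S \<epsilon>)))"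
    unfolding approx_unit_def
  proof (rule eventually_INF_base)
    show "?B \<noteq> {}" by (auto intro: exI[of _ "{}"] exI[of _ 1])
    fix i j assume "i \<in> ?B" "j \<in> ?B"
    then obtain S \<epsilon> T \<eta> where ij: "i = (S, \<epsilon>)" "j = (T, \<eta>)" "finite S" "\<epsilon> > 0" "finite T" "\<eta> > 0"
      by auto
    have "local_units (S \<union> T) (min \<epsilon> \<eta>) \<subseteq> local_units S \<epsilon> \<inter> local_units T \<eta>"
      by (auto simp: local_units_def)
    then show "\<exists>x\<in>?B. (case x of (S, \<epsilon>) \<Rightarrow> principal (local_units S \<epsilon>))
        \<le> inf (case i of (S, \<epsilon>) \<Rightarrow> principal (local_units S \<epsilon>)) (case j of (S, \<epsilon>) \<Rightarrow> principal (local_units S \<epsilon>))"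
      using ij by (intro bexI[of _ "(S \<union> T, min \<epsilon> \<eta>)"]) auto
  qed
  then show ?thesis by (auto simp: eventually_principal)
qed

lemma approx_unit_nontrivial [simp]: "(approx_unit :: 'a::cstar_algebra filter) \<noteq> bot"
  unfolding trivial_limit_def eventually_approx_unit using local_units_nonempty by blast

lemma approx_unit_bounded: "\<forall>\<^sub>F w in approx_unit. norm w \<le> 8"
  unfolding eventually_approx_unit by (intro exI[of _ "{}"] exI[of _ 1]) (auto simp: local_units_def)

lemma approx_unit_left: "((\<lambda>w. w * a) \<longlongrightarrow> a) approx_unit"
  and approx_unit_right: "((\<lambda>w. a * w) \<longlongrightarrow> a) approx_unit"
proof -
  have "\<forall>\<^sub>F w in approx_unit. norm (a - w * a) < e \<and> norm (a - a * w) < e" if "e > 0" for e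
    unfolding eventually_approx_unit using that
    by (intro exI[of _ "{a}"] exI[of _ "e / 2"]) (auto simp: local_units_def)
  then show "((\<lambda>w. w * a) \<longlongrightarrow> a) approx_unit" "((\<lambda>w. a * w) \<longlongrightarrow> a) approx_unit"
    unfolding tendsto_iff dist_norm
    by (simp_all add: norm_minus_commute[of _ a]) (metis (mono_tags, lifting) eventually_mono)+
qed

section \<open>Bilinear maps vanishing on orthogonal functions\<close>

definition ramp :: "nat \<Rightarrow> real \<Rightarrow> real"
  where "ramp i s = max 0 (min 1 (s - real i))"

lemma ramp_bounds: "0 \<le> ramp i s" "ramp i s \<le> 1"
  by (auto simp: ramp_def)

lemma ramp_antimono: "i \<le> j \<Longrightarrow> ramp j s \<le> ramp i s"
  by (auto simp: ramp_def)

lemma ramp_eq_1: "j < i \<Longrightarrow> ramp i s \<noteq> 0 \<Longrightarrow> ramp j s = 1"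
  by (auto simp: ramp_def max_def min_def split: if_splits)

lemma sum_ramp: "0 \<le> s \<Longrightarrow> (\<Sum>i<k. ramp i s) = min s (real k)"
  by (induction k) (auto simp: ramp_def min_def max_def)

lemma sum_blocks4:
  "(\<Sum>i<4*m. f i) = (\<Sum>q<m. f (4*q) + f (4*q+1) + f (4*q+2) + f (4*q+3 :: nat) :: real)"
  by (induction m) (simp_all add: numeral_eq_Suc)

text \<open>As \<open>s \<le> r + 4\<close>, the index intervals from \<open>4q+r\<close> to
  \<open>4q+s\<close> do not overlap, so the drops of a decreasing sequence along them add up to at
  most its total drop.\<close>

lemma antimono_block_sum:
  fixes a :: "nat \<Rightarrow> real"
  assumes a: "\<And>i j. i \<le> j \<Longrightarrow> a j \<le> a i" "\<And>i. 0 \<le> a i" "\<And>i. a i \<le> 1" and rs: "r \<le> s" "s \<le> r + 4"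
  shows "0 \<le> (\<Sum>q<m. a (4*q+r) - a (4*q+s))" "(\<Sum>q<m. a (4*q+r) - a (4*q+s)) \<le> 1"
proof -
  show "0 \<le> (\<Sum>q<m. a (4*q+r) - a (4*q+s))"
    using rs by (intro sum_nonneg) (simp add: a)
  have "(\<Sum>q<m. a (4*q+r) - a (4*q+s)) \<le> a r - a (4*m+r)"
  proof (induction m)
    case (Suc m)
    have "a (4 * Suc m + r) \<le> a (4*m+s)" using rs by (intro a) simp
    then show ?case using Suc by simp
  qed simp
  then show "(\<Sum>q<m. a (4*q+r) - a (4*q+s)) \<le> 1"
    using a(2)[of "4*m+r"] a(3)[of r] by linarith
qed

context sa_contraction
begin

text \<open>The quantification over \<open>c\<close> makes \<open>b\<close> orthogonal to all functions of \<open>h\<close> supported where \<open>f\<close> is,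
  in particular to the factors of a factorization of \<open>f\<close>.\<close>

definition orth :: "('a \<Rightarrow> 'a \<Rightarrow> 'c::real_normed_vector) \<Rightarrow> bool"
  where "orth \<psi> \<longleftrightarrow> (\<forall>f b. C0 f \<longrightarrow>
    (\<forall>c. C0 c \<longrightarrow> (\<forall>t. f t = 0 \<longrightarrow> c t = 0) \<longrightarrow> fc h c * b = 0 \<and> b * fc h c = 0) \<longrightarrow>
    \<psi> (fc h f) b = 0)"

lemma orthD:
  assumes "orth \<psi>" "C0 f"
    "\<And>c. C0 c \<Longrightarrow> (\<And>t. f t = 0 \<Longrightarrow> c t = 0) \<Longrightarrow> fc h c * b = 0 \<and> b * fc h c = 0"
  shows "\<psi> (fc h f) b = 0"
  using assms unfolding orth_def by blast

lemma orth_disjoint: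
  assumes "orth \<psi>" "C0 f" "C0 g" "\<And>t. \<bar>t\<bar> \<le> 1 \<Longrightarrow> f t \<noteq> 0 \<Longrightarrow> g t = 0"
  shows "\<psi> (fc h f) (fc h g) = 0"
proof (rule orthD[OF assms(1,2)])
  fix c assume c: "C0 c" "\<And>t. f t = 0 \<Longrightarrow> c t = 0"
  have "fc h (\<lambda>t. c t * g t) = fc h (\<lambda>t. 0)"
    using c(2) assms(4) by (intro fc_cong) (metis mult_eq_0_iff)
  then show "fc h c * fc h g = 0 \<and> fc h g * fc h c = 0"
    using c(1) assms(3) by (simp add: fc_mult fc_0 fc_commute)
qed

text \<open>Cut \<open>4 m f\<close> into ramps \<open>P i\<close>. Orthogonality gives \<open>\<psi>(P i, P j) = \<psi>(P i, g)\<close> for \<open>j < i\<close> and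
  \<open>\<psi>(g, P j)\<close> for \<open>i < j\<close>. The trapezoidal waves \<open>F = \<Sum>\<^sub>q P (4q) - P (4q+2)\<close> and
  \<open>G = \<Sum>\<^sub>q P (4q+1) - P (4q+3)\<close> have norm at most \<open>1\<close>, and in \<open>\<psi>(F, G)\<close> everything cancels except
  \<open>\<Sum>\<^sub>q \<psi>(g, P (4q+1)) - \<psi>(P (4q+2), g)\<close>, which is \<open>m (\<psi>(g, f) - \<psi>(f, g))\<close> up to a bounded error.\<close>

lemma orth_symmetric_nonneg:
  fixes \<psi> :: "'a \<Rightarrow> 'a \<Rightarrow> 'c::real_normed_vector"
  assumes bb: "bounded_bilinear \<psi>" and orth: "orth \<psi>"
    and f: "C0 f" "\<And>t. 0 \<le> f t" "\<And>t. \<bar>t\<bar> \<le> 1 \<Longrightarrow> f t \<le> 1"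
    and g: "C0 g" "\<And>t. \<bar>t\<bar> \<le> 1 \<Longrightarrow> f t \<noteq> 0 \<Longrightarrow> g t = 1"
  shows "\<psi> (fc h g) (fc h f) = \<psi> (fc h f) (fc h g)"
proof -
  interpret \<psi>: bounded_bilinear \<psi> by (rule bb)
  obtain K where K: "K \<ge> 0" "\<And>a b. norm (\<psi> a b) \<le> norm a * norm b * K"
    using \<psi>.nonneg_bounded by blast
  let ?x = "fc h f" and ?g = "fc h g"
  \<comment> \<open>\<open>D\<close> does not depend on \<open>m\<close>: two errors of at most
    \<open>3 * norm ?g * K\<close> from the approximations of \<open>4 m f\<close>, and
    \<open>4 K\<close> from \<open>4 \<psi>(F, G)\<close>.\<close>
  define D where "D = 6 * (norm ?g * K) + 4 * K"
  have main: "norm (\<psi> ?g ?x - \<psi> ?x ?g) * real (4 * m) \<le> D" for m :: nat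
  proof -
    define P where "P = (\<lambda>i t. ramp i (real (4 * m) * f t))"
    define e where "e = (\<lambda>i. fc h (P i))"
    have P0: "P i t = 0" if "f t = 0" for i t using that by (simp add: P_def ramp_def)
    have CP: "C0 (P i)" for i
      using f(1) unfolding C0_def P_def ramp_def by (auto intro!: continuous_intros)
    have left: "\<psi> (e i) (e j) = \<psi> (e i) ?g" if "j < i" for i j
    proof -
      have "\<psi> (fc h (P i)) (fc h (\<lambda>t. P j t - g t)) = 0"
      proof (rule orth_disjoint[OF orth CP C0_intros(2)[OF CP g(1)]])
        fix t :: real assume "\<bar>t\<bar> \<le> 1" "P i t \<noteq> 0"
        then show "P j t - g t = 0"
          using ramp_eq_1[OF that, of "real (4 * m) * f t"] P0[of t i] g(2)[of t]
          by (cases "f t = 0") (auto simp: P_def)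
      qed
      then show ?thesis by (simp add: e_def fc_diff CP g \<psi>.diff_right)
    qed
    have right: "\<psi> (e i) (e j) = \<psi> ?g (e j)" if "i < j" for i j
    proof -
      have "\<psi> (fc h (\<lambda>t. P i t - g t)) (fc h (P j)) = 0"
      proof (rule orth_disjoint[OF orth C0_intros(2)[OF CP g(1)] CP])
        fix t :: real assume "\<bar>t\<bar> \<le> 1" "P i t - g t \<noteq> 0"
        then show "P j t = 0"
          using ramp_eq_1[OF that, of "real (4 * m) * f t"] P0[of t j] g(2)[of t]
          by (cases "f t = 0") (auto simp: P_def)
      qed
      then show ?thesis by (simp add: e_def fc_diff CP g \<psi>.diff_left)
    qed
    have block: "0 \<le> (\<Sum>q<m. P (4*q+r) t - P (4*q+s) t)" "(\<Sum>q<m. P (4*q+r) t - P (4*q+s) t) \<le> 1"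
      if "r \<le> s" "s \<le> r + 4" for r s t
      using antimono_block_sum[of "\<lambda>i. P i t" r s m] that ramp_antimono ramp_bounds
      by (auto simp: P_def)
    have sumP: "(\<Sum>q<m. P (4*q) t + P (4*q+1) t + P (4*q+2) t + P (4*q+3) t) = real (4 * m) * f t"
      if "\<bar>t\<bar> \<le> 1" for t
    proof -
      have "real (4 * m) * f t \<le> real (4 * m) * 1"
        using f(3)[OF that] by (intro mult_left_mono) auto
      then have "(\<Sum>i<4*m. P i t) = real (4 * m) * f t"
        using sum_ramp[of "real (4 * m) * f t" "4 * m"] f(2)[of t] by (simp add: P_def)
      then show ?thesis by (simp only: sum_blocks4)
    qed
    define F where "F = (\<Sum>q<m. e (4*q) - e (4*q+2))"
    define G where "G = (\<Sum>q<m. e (4*q+1) - e (4*q+3))"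
    have "F = fc h (\<lambda>t. \<Sum>q<m. P (4*q) t - P (4*q+2) t)"
      by (simp add: F_def e_def fc_sum fc_diff CP C0_intros)
    moreover have "norm (fc h (\<lambda>t. \<Sum>q<m. P (4*q) t - P (4*q+2) t)) \<le> 1"
      using block[of 0 2] by (intro fc_norm C0_sum C0_intros CP) (auto simp: abs_le_iff intro: order_trans[of _ 0])
    ultimately have nF: "norm F \<le> 1" by simp
    have "G = fc h (\<lambda>t. \<Sum>q<m. P (4*q+1) t - P (4*q+3) t)"
      by (simp add: G_def e_def fc_sum fc_diff CP C0_intros)
    moreover have "norm (fc h (\<lambda>t. \<Sum>q<m. P (4*q+1) t - P (4*q+3) t)) \<le> 1"
      using block[of 1 3] by (intro fc_norm C0_sum C0_intros CP) (auto simp: abs_le_iff intro: order_trans[of _ 0])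
    ultimately have nG: "norm G \<le> 1" by simp
    \<comment> \<open>For \<open>q \<noteq> r\<close> all four terms depend on one of the two
      arguments only, so the differences cancel. For \<open>q = r\<close> the indices
      \<open>4q+1 < 4q+2\<close> are the only pair in the opposite order, which leaves one term of
      each kind.\<close>
    have cell: "\<psi> (e (4*q) - e (4*q+2)) (e (4*r+1) - e (4*r+3))
        = (if r = q then \<psi> ?g (e (4*q+1)) - \<psi> (e (4*q+2)) ?g else 0)" for q r
    proof (cases q r rule: linorder_cases)
      case less
      then show ?thesis by (simp add: \<psi>.diff_left \<psi>.diff_right right)
    next
      case equal
      then show ?thesis
        using left[of "4*q+1" "4*q+2"] right[of "4*q" "4*q+1"] right[of "4*q" "4*q+3"] right[of "4*q+2" "4*q+3"]
        by (simp add: \<psi>.diff_left \<psi>.diff_right)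
    next
      case greater
      then show ?thesis by (simp add: \<psi>.diff_left \<psi>.diff_right left)
    qed
    have FG: "\<psi> F G = (\<Sum>q<m. \<psi> ?g (e (4*q+1)) - \<psi> (e (4*q+2)) ?g)"
      unfolding F_def G_def \<psi>.sum_left \<psi>.sum_right cell by (simp add: sum.delta)
    define u where "u = (\<Sum>q<m. e (4*q+1))"
    define v where "v = (\<Sum>q<m. e (4*q+2))"
    have FG': "\<psi> F G = \<psi> ?g u - \<psi> v ?g"
      by (simp add: FG u_def v_def \<psi>.sum_left \<psi>.sum_right sum_subtractf)
    \<comment> \<open>The sums of the ramps over the four residue classes modulo \<open>4\<close>
      pairwise differ by at most \<open>1\<close>, and together they give \<open>4 m f\<close>.
      Replacing the three others by the class of \<open>j\<close> costs at most
      \<open>3\<close>.\<close>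
    have dist: "norm (real (4 * m) *\<^sub>R ?x - 4 *\<^sub>R (\<Sum>q<m. e (4*q+j))) \<le> 3" if "j = 1 \<or> j = 2" for j
    proof -
      have "real (4 * m) *\<^sub>R ?x - 4 *\<^sub>R (\<Sum>q<m. e (4*q+j))
          = fc h (\<lambda>t. real (4 * m) * f t - 4 * (\<Sum>q<m. P (4*q+j) t))"
        by (simp only: e_def fc_sum fc_diff fc_scale CP C0_sum C0_intros f(1))
      also have "norm \<dots> \<le> 3"
      proof (rule fc_norm)
        show "C0 (\<lambda>t. real (4 * m) * f t - 4 * (\<Sum>q<m. P (4*q+j) t))"
          by (intro C0_intros C0_sum CP f)
        fix t :: real assume t: "\<bar>t\<bar> \<le> 1"
        show "\<bar>real (4 * m) * f t - 4 * (\<Sum>q<m. P (4*q+j) t)\<bar> \<le> 3"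
          using that block[of 0 1 t] block[of 1 2 t] block[of 1 3 t] block[of 0 2 t] block[of 2 3 t]
          unfolding sumP[OF t, symmetric] sum.distrib sum_subtractf abs_le_iff by auto
      qed
      finally show ?thesis .
    qed
    have "real (4 * m) *\<^sub>R (\<psi> ?g ?x - \<psi> ?x ?g)
        = \<psi> ?g (real (4 * m) *\<^sub>R ?x - 4 *\<^sub>R u) - \<psi> (real (4 * m) *\<^sub>R ?x - 4 *\<^sub>R v) ?g + 4 *\<^sub>R \<psi> F G"
      unfolding FG' by (simp add: \<psi>.diff_left \<psi>.diff_right \<psi>.scaleR_left \<psi>.scaleR_right algebra_simps)
    also have "norm \<dots> \<le> norm ?g * 3 * K + 3 * norm ?g * K + 4 * (1 * 1 * K)"
    proof (intro norm_triangle_mono order_trans[OF norm_triangle_ineq4] add_mono)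
      show "norm (\<psi> ?g (real (4 * m) *\<^sub>R ?x - 4 *\<^sub>R u)) \<le> norm ?g * 3 * K"
        using dist[of 1] K by (intro order_trans[OF K(2)] mult_mono) (auto simp: u_def)
      show "norm (\<psi> (real (4 * m) *\<^sub>R ?x - 4 *\<^sub>R v) ?g) \<le> 3 * norm ?g * K"
        using dist[of 2] K by (intro order_trans[OF K(2)] mult_mono) (auto simp: v_def)
      have "norm (\<psi> F G) \<le> 1 * 1 * K"
        using nF nG K(1) by (intro order_trans[OF K(2)] mult_mono) auto
      then show "norm (4 *\<^sub>R \<psi> F G) \<le> 4 * (1 * 1 * K)" by simp
    qed
    finally show ?thesis by (simp add: D_def mult.commute)
  qed
  have "norm (\<psi> ?g ?x - \<psi> ?x ?g) = 0"
  proof (rule ccontr)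
    assume "norm (\<psi> ?g ?x - \<psi> ?x ?g) \<noteq> 0"
    then have pos: "norm (\<psi> ?g ?x - \<psi> ?x ?g) > 0" by simp
    then obtain m where m: "D < real m * norm (\<psi> ?g ?x - \<psi> ?x ?g)"
      using reals_Archimedean3 by blast
    also have "\<dots> \<le> norm (\<psi> ?g ?x - \<psi> ?x ?g) * real (4 * m)"
      by (simp add: mult.commute mult_left_mono)
    finally show False using main[of m] by simp
  qed
  then show ?thesis by simp
qed

text \<open>Positive and negative parts reduce this to the nonnegative case. Scaling by
  \<open>M + 1\<close> instead of \<open>M\<close> avoids a division by zero.\<close>

lemma orth_symmetric:
  fixes \<psi> :: "'a \<Rightarrow> 'a \<Rightarrow> 'c::real_normed_vector"
  assumes bb: "bounded_bilinear \<psi>" and orth: "orth \<psi>"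
    and f: "C0 f" and g: "C0 g" "\<And>t. \<bar>t\<bar> \<le> 1 \<Longrightarrow> f t \<noteq> 0 \<Longrightarrow> g t = 1"
  shows "\<psi> (fc h g) (fc h f) = \<psi> (fc h f) (fc h g)"
proof -
  interpret \<psi>: bounded_bilinear \<psi> by (rule bb)
  obtain M where M: "M \<ge> 0" "\<And>t. \<bar>t\<bar> \<le> 1 \<Longrightarrow> \<bar>f t\<bar> \<le> M" using C0_bounded[OF f] by blast
  define f1 where "f1 = (\<lambda>t. max 0 (f t / (M + 1)))"
  define f2 where "f2 = (\<lambda>t. max 0 (- f t / (M + 1)))"
  have C: "C0 f1" "C0 f2"
    using f M(1) by (auto simp: C0_def f1_def f2_def intro!: continuous_intros)
  have "\<psi> (fc h g) (fc h f1) = \<psi> (fc h f1) (fc h g)"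
  proof (rule orth_symmetric_nonneg[OF bb orth C(1) _ _ g(1)])
    fix t :: real assume t: "\<bar>t\<bar> \<le> 1"
    show "f1 t \<le> 1" using M(1) M(2)[OF t] by (simp add: f1_def divide_simps)
    show "g t = 1" if "f1 t \<noteq> 0" using that g(2)[OF t] by (cases "f t = 0") (auto simp: f1_def)
  qed (simp add: f1_def)
  moreover have "\<psi> (fc h g) (fc h f2) = \<psi> (fc h f2) (fc h g)"
  proof (rule orth_symmetric_nonneg[OF bb orth C(2) _ _ g(1)])
    fix t :: real assume t: "\<bar>t\<bar> \<le> 1"
    show "f2 t \<le> 1" using M(1) M(2)[OF t] by (simp add: f2_def divide_simps)
    show "g t = 1" if "f2 t \<noteq> 0" using that g(2)[OF t] by (cases "f t = 0") (auto simp: f2_def)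
  qed (simp add: f2_def)
  moreover have "fc h f = (M + 1) *\<^sub>R fc h f1 + (- (M + 1)) *\<^sub>R fc h f2"
  proof -
    have "f = (\<lambda>t. (M + 1) * f1 t + (- (M + 1)) * f2 t)"
    proof
      fix t
      have "max 0 (f t / (M + 1)) - max 0 (- f t / (M + 1)) = f t / (M + 1)"
        by (cases "f t / (M + 1) \<ge> 0") (auto simp: max_def)
      then have "(M + 1) * (f1 t - f2 t) = f t" using M(1) by (simp add: f1_def f2_def)
      then show "f t = (M + 1) * f1 t + (- (M + 1)) * f2 t" by (simp add: algebra_simps)
    qed
    then show ?thesis using fc_lin[OF C, of "M + 1" "- (M + 1)"] by metis
  qed
  ultimately show ?thesis
    by (simp only: \<psi>.add_left \<psi>.add_right \<psi>.scaleR_left \<psi>.scaleR_right)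
qed

text \<open>A general \<open>w\<close> does not commute with \<open>h\<close>. However,
  \<open>(1 - g) w (1 - g)\<close> is orthogonal to everything supported where \<open>f\<close> is,
  so \<open>w\<close> may be replaced by \<open>w g + g w - g w g\<close>. This converges in norm to
  \<open>2 g - g^2\<close>, and \<open>g - g^2\<close> vanishes where \<open>f\<close> does
  not.\<close>

lemma orth_tendsto:
  fixes \<psi> :: "'a \<Rightarrow> 'a \<Rightarrow> 'c::real_normed_vector"
  assumes bb: "bounded_bilinear \<psi>" and orth: "orth \<psi>"
    and f: "C0 f" and g: "C0 g" "\<And>t. \<bar>t\<bar> \<le> 1 \<Longrightarrow> f t \<noteq> 0 \<Longrightarrow> g t = 1"
  shows "((\<lambda>w. \<psi> (fc h f) w) \<longlongrightarrow> \<psi> (fc h f) (fc h g)) approx_unit"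
proof -
  interpret \<psi>: bounded_bilinear \<psi> by (rule bb)
  let ?x = "fc h f" and ?g = "fc h g"
  have "\<psi> ?x w = \<psi> ?x (w * ?g + ?g * w - ?g * (w * ?g))" for w
  proof -
    have "\<psi> ?x (w - (w * ?g + ?g * w - ?g * (w * ?g))) = 0"
    proof (rule orthD[OF orth f])
      fix c assume c: "C0 c" "\<And>t. f t = 0 \<Longrightarrow> c t = 0"
      have "fc h (\<lambda>t. c t * g t) = fc h c"
        using c(2) g(2) by (intro fc_cong) (metis mult.right_neutral mult_zero_left)
      then have cg: "fc h c * ?g = fc h c" "?g * fc h c = fc h c"
        using c(1) g(1) by (auto simp: fc_mult fc_commute)
      have "fc h c * (?g * y) = fc h c * y" for y using cg by (simp flip: mult.assoc)
      then show "fc h c * (w - (w * ?g + ?g * w - ?g * (w * ?g))) = 0 \<and>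
          (w - (w * ?g + ?g * w - ?g * (w * ?g))) * fc h c = 0"
        by (simp add: algebra_simps cg)
    qed
    then show ?thesis by (simp add: \<psi>.diff_right)
  qed
  moreover have "((\<lambda>w. \<psi> ?x (w * ?g + ?g * w - ?g * (w * ?g))) \<longlongrightarrow> \<psi> ?x (?g + ?g - ?g * ?g)) approx_unit"
    by (intro \<psi>.tendsto tendsto_intros approx_unit_left approx_unit_right)
  moreover have "\<psi> ?x (?g + ?g - ?g * ?g) = \<psi> ?x ?g"
  proof -
    have "\<psi> ?x (fc h (\<lambda>t. g t - g t * g t)) = 0"
      using g(2) by (intro orth_disjoint[OF orth f] C0_intros g(1)) simp
    then show ?thesis using g(1) by (simp add: fc_diff fc_mult C0_intros \<psi>.diff_right \<psi>.add_right)
  qed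
  ultimately show ?thesis by simp
qed

end

text \<open>Soft thresholding: it is within \<open>\<delta>\<close> of the identity and vanishes on
  \<open>[-\<delta>, \<delta>]\<close>, so that \<open>cutoff \<delta>\<close> equals
  \<open>1\<close> on its support.\<close>

definition soft :: "real \<Rightarrow> real \<Rightarrow> real"
  where "soft \<delta> t = max 0 (t - \<delta>) - max 0 (- t - \<delta>)"

lemma C0_soft: "\<delta> > 0 \<Longrightarrow> C0 (soft \<delta>)"
  unfolding C0_def soft_def by (auto intro!: continuous_intros)

lemma soft_close: "\<delta> > 0 \<Longrightarrow> \<bar>t - soft \<delta> t\<bar> \<le> \<delta>"
  by (auto simp: soft_def max_def)

lemma cutoff_eq_1: "\<delta> > 0 \<Longrightarrow> soft \<delta> t \<noteq> 0 \<Longrightarrow> cutoff \<delta> t = 1"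
proof -
  assume "\<delta> > 0" "soft \<delta> t \<noteq> 0"
  then have "\<bar>t\<bar> \<ge> \<delta>" by (auto simp: soft_def max_def split: if_splits)
  then show ?thesis using \<open>\<delta> > 0\<close> by (simp add: cutoff_def)
qed

lemma (in sa_contraction) fc_soft_tendsto: "(\<lambda>n. fc h (soft (1 / real (Suc n)))) \<longlonglongrightarrow> h"
proof -
  have le: "norm (fc h (soft (1 / real (Suc n))) - h) \<le> 1 / real (Suc n)" for n
  proof -
    let ?s = "soft (1 / real (Suc n))"
    have "norm (fc h (\<lambda>t. t - ?s t)) \<le> 1 / real (Suc n)"
      by (intro fc_norm C0_intros C0_soft soft_close) auto
    then show ?thesis by (simp add: fc_diff C0_intros C0_soft fc_id norm_minus_commute)
  qed
  have lim: "(\<lambda>n. 1 / real (Suc n)) \<longlonglongrightarrow> 0"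
    using LIMSEQ_inverse_real_of_nat by (simp add: inverse_eq_divide)
  have "(\<lambda>n. fc h (soft (1 / real (Suc n))) - h) \<longlonglongrightarrow> 0"
    by (rule Lim_null_comparison[OF _ lim]) (use le in simp)
  then show ?thesis by (simp add: LIM_zero_iff)
qed

lemma approx_unit_limit:
  assumes bb: "bounded_bilinear \<psi>" and x: "x \<longlonglongrightarrow> a" and l: "l \<longlonglongrightarrow> L"
    and lim: "\<And>n. ((\<lambda>w. \<psi> (x n) w) \<longlongrightarrow> l n) (approx_unit :: 'a::cstar_algebra filter)"
  shows "((\<lambda>w. \<psi> a w) \<longlongrightarrow> L) approx_unit"
proof (rule tendstoI)
  interpret \<psi>: bounded_bilinear \<psi> by (rule bb)
  obtain K where K: "K > 0" "\<And>a b. norm (\<psi> a b) \<le> norm a * norm b * K"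
    using \<psi>.pos_bounded by blast
  fix e :: real assume e: "e > 0"
  \<comment> \<open>The \<open>24\<close> is \<open>3 * 8\<close>: a third of the error, against the
    norm bound \<open>8\<close> along \<open>approx_unit\<close>.\<close>
  have "\<forall>\<^sub>F n in sequentially. dist (x n) a < e / (24 * K)"
    using e K by (intro tendstoD[OF x]) simp
  moreover have "\<forall>\<^sub>F n in sequentially. dist (l n) L < e / 3"
    using e by (intro tendstoD[OF l]) simp
  ultimately have "\<forall>\<^sub>F n in sequentially. dist (x n) a < e / (24 * K) \<and> dist (l n) L < e / 3"
    by (rule eventually_conj)
  then obtain n where n: "norm (a - x n) < e / (24 * K)" "norm (l n - L) < e / 3"
    by (auto simp: dist_norm norm_minus_commute dest: eventually_happens)
  have "\<forall>\<^sub>F w in approx_unit. dist (\<psi> (x n) w) (l n) < e / 3"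
    using e by (intro tendstoD[OF lim]) simp
  then show "\<forall>\<^sub>F w in approx_unit. dist (\<psi> a w) L < e"
    using approx_unit_bounded
  proof eventually_elim
    case (elim w)
    have "norm (\<psi> (a - x n) w) \<le> norm (a - x n) * norm w * K" by (rule K)
    also have "\<dots> \<le> (e / (24 * K)) * 8 * K"
      using n elim K e by (intro mult_mono) auto
    also have "\<dots> = e / 3" using K by simp
    finally have "norm (\<psi> (a - x n) w) \<le> e / 3" .
    moreover have "\<psi> a w - L = \<psi> (a - x n) w + (\<psi> (x n) w - l n) + (l n - L)"
      by (simp add: \<psi>.diff_left)
    ultimately show ?case
      using n elim norm_triangle_ineq[of "\<psi> (a - x n) w + (\<psi> (x n) w - l n)" "l n - L"]
        norm_triangle_ineq[of "\<psi> (a - x n) w" "\<psi> (x n) w - l n"]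
      by (simp add: dist_norm)
  qed
qed

section \<open>Bounded preimages\<close>

text \<open>Correcting the residual again and again halves it each time. The corrections are
  dominated by a geometric series, whose sum accounts for the factor \<open>2\<close>.\<close>

lemma approx_surj_imp_bounded_preimage:
  fixes f :: "'a::banach \<Rightarrow> 'b::real_normed_vector"
  assumes f: "bounded_linear f" and L: "L \<ge> 0"
    and approx: "\<And>z. \<exists>x. norm x \<le> L * norm z \<and> norm (z - f x) \<le> norm z / 2"
  shows "\<exists>x. f x = y \<and> norm x \<le> 2 * L * norm y"
proof -
  interpret f: bounded_linear f by (rule f)
  obtain g where g: "\<And>z. norm (g z) \<le> L * norm z" "\<And>z. norm (z - f (g z)) \<le> norm z / 2"
    using approx by metis
  define z where "z = (\<lambda>n. ((\<lambda>z. z - f (g z)) ^^ n) y)"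
  have z_Suc: "z (Suc n) = z n - f (g (z n))" for n by (simp add: z_def)
  have nz: "norm (z n) \<le> norm y * (1/2) ^ n" for n
  proof (induction n)
    case (Suc n)
    then show ?case using g(2)[of "z n"] unfolding z_Suc by simp
  qed (simp add: z_def)
  have ng: "norm (g (z n)) \<le> L * norm y * (1/2) ^ n" for n
    using g(1)[of "z n"] mult_left_mono[OF nz[of n] L] by (simp add: mult.assoc)
  have sm: "summable (\<lambda>n. L * norm y * (1/2) ^ n)"
    by (intro summable_mult summable_geometric) simp
  have sn: "summable (\<lambda>n. norm (g (z n)))"
    by (rule summable_comparison_test'[OF sm]) (simp add: ng)
  then have sg: "summable (\<lambda>n. g (z n))" by (rule summable_norm_cancel)
  have "(\<Sum>k<n. f (g (z k))) = y - z n" for n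
  proof (induction n)
    case 0
    then show ?case by (simp add: z_def)
  qed (simp add: z_Suc)
  moreover have "z \<longlonglongrightarrow> 0"
  proof (rule Lim_null_comparison)
    show "(\<lambda>n. norm y * (1/2) ^ n) \<longlonglongrightarrow> 0"
      by (intro tendsto_mult_right_zero LIMSEQ_power_zero) simp
  qed (use nz in simp)
  then have "(\<lambda>n. y - z n) \<longlonglongrightarrow> y - 0" by (intro tendsto_intros)
  ultimately have "(\<lambda>n. f (g (z n))) sums y" by (simp add: sums_def)
  moreover have "(\<lambda>n. f (g (z n))) sums f (\<Sum>n. g (z n))"
    by (rule f.sums[OF summable_sums[OF sg]])
  ultimately have "f (\<Sum>n. g (z n)) = y" by (simp add: sums_unique2)
  moreover have "norm (\<Sum>n. g (z n)) \<le> 2 * L * norm y"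
  proof -
    have "norm (\<Sum>n. g (z n)) \<le> (\<Sum>n. norm (g (z n)))" by (rule summable_norm[OF sn])
    also have "\<dots> \<le> (\<Sum>n. L * norm y * (1/2) ^ n)" by (rule suminf_le[OF ng sn sm])
    also have "\<dots> = L * norm y * (\<Sum>n. (1/2) ^ n)"
      by (intro suminf_mult summable_geometric) simp
    also have "\<dots> = 2 * L * norm y"
      by (simp add: suminf_geometric)
    finally show ?thesis .
  qed
  ultimately show ?thesis by blast
qed

text \<open>The open mapping theorem in quantitative form. By Baire, the closure of the image of
  some ball has interior; differences of its points give preimages near \<open>0\<close> up to any
  error, and successive approximation removes the error.\<close>

theorem bounded_preimage:
  fixes f :: "'a::banach \<Rightarrow> 'b::banach"
  assumes f: "bounded_linear f" and surj: "surj f"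
  shows "\<exists>C\<ge>0. \<forall>y. \<exists>x. f x = y \<and> norm x \<le> C * norm y"
proof -
  interpret f: bounded_linear f by (rule f)
  define V where "V = (\<lambda>n::nat. closure (f ` cball 0 (real n)))"
  have UV: "(\<Union>n. V n) = UNIV"
  proof -
    have "y \<in> (\<Union>n. V n)" for y
    proof -
      obtain x where x: "y = f x" using surj by blast
      obtain n where "norm x \<le> real n" using real_arch_simple by blast
      then have "y \<in> f ` cball 0 (real n)" using x by simp
      then have "y \<in> V n" unfolding V_def by (rule closure_subset[THEN subsetD])
      then show ?thesis by blast
    qed
    then show ?thesis by blast
  qed
  have "\<exists>n. interior (V n) \<noteq> {}"
  proof (rule ccontr)
    assume "\<not> (\<exists>n. interior (V n) \<noteq> {})"
    then have empty: "interior (V n) = {}" for n by blast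
    have int: "euclidean interior_of T = interior T" for T :: "'b set"
      by (auto simp: interior_of_def interior_def)
    have "Met_TC.mtopology interior_of (\<Union>(range V)) = {}"
    proof (rule Met_TC.metric_Baire_category_alt)
      show "Met_TC.mcomplete TYPE('b)" by (simp add: complete_UNIV)
      fix T assume "T \<in> range V"
      then obtain n where "T = V n" by blast
      then show "closedin Met_TC.mtopology T \<and> Met_TC.mtopology interior_of T = {}"
        using empty[of n] by (simp add: int) (simp add: V_def)
    qed simp
    moreover have "euclidean interior_of (UNIV :: 'b set) = UNIV"
      using interior_of_topspace[of "euclidean :: 'b topology"] by simp
    ultimately show False using UV by simp
  qed
  then obtain n y where "y \<in> interior (V n)" by blast
  then obtain r where r: "r > 0" "ball y r \<subseteq> V n"
    by (meson interior_subset open_contains_ball open_interior order_trans)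
  have near: "\<exists>x. norm x \<le> 2 * real n \<and> norm (z - f x) < \<epsilon>" if z: "norm z < r" and \<epsilon>: "\<epsilon> > 0" for z \<epsilon>
  proof -
    have "y + z \<in> V n" "y \<in> V n" using r z by (auto simp: subset_iff dist_norm)
    then obtain u v where u: "u \<in> f ` cball 0 (real n)" "dist u (y + z) < \<epsilon> / 2"
      and v: "v \<in> f ` cball 0 (real n)" "dist v y < \<epsilon> / 2"
      unfolding V_def closure_approachable using \<epsilon> by (metis half_gt_zero)
    then obtain a b where ab: "u = f a" "v = f b" "norm a \<le> real n" "norm b \<le> real n" by auto
    have "z - f (a - b) = (v - y) - (u - (y + z))" using ab by (simp add: f.diff)
    then have "norm (z - f (a - b)) \<le> norm (v - y) + norm (u - (y + z))"
      by (metis norm_triangle_ineq4)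
    then have "norm (z - f (a - b)) < \<epsilon>" using u v by (simp add: dist_norm)
    moreover have "norm (a - b) \<le> 2 * real n" using norm_triangle_ineq4[of a b] ab by simp
    ultimately show ?thesis by blast
  qed
  \<comment> \<open>\<open>z\<close> is rescaled to norm \<open>r / 2\<close>, where a preimage of
    norm at most \<open>2 n\<close> exists; undoing the scaling multiplies by
    \<open>2 * norm z / r\<close>.\<close>
  define L where "L = 4 * real n / r"
  have "L \<ge> 0" using r by (simp add: L_def)
  have "\<exists>x. norm x \<le> L * norm z \<and> norm (z - f x) \<le> norm z / 2" for z
  proof (cases "z = 0")
    case False
    define s where "s = r / (2 * norm z)"
    have s: "s > 0" using r False by (simp add: s_def)
    have "norm (s *\<^sub>R z) < r" using r False by (simp add: s_def)
    then obtain x where x: "norm x \<le> 2 * real n" "norm (s *\<^sub>R z - f x) < s * norm z / 2"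
      using near[of "s *\<^sub>R z" "s * norm z / 2"] s False by auto
    let ?x = "(1 / s) *\<^sub>R x"
    have "norm ?x \<le> L * norm z"
      using x(1) s r False by (simp add: L_def s_def field_simps)
    have eq: "z - f ?x = (1 / s) *\<^sub>R (s *\<^sub>R z - f x)"
      using s by (simp add: f.scaleR scaleR_diff_right)
    have "norm (z - f ?x) = norm (s *\<^sub>R z - f x) / s"
      unfolding eq norm_scaleR using s by simp
    also have "\<dots> \<le> (s * norm z / 2) / s"
      using x(2) s by (intro divide_right_mono) auto
    also have "\<dots> = norm z / 2" using s by simp
    finally have "norm (z - f ?x) \<le> norm z / 2" .
    moreover note \<open>norm ?x \<le> L * norm z\<close>
    ultimately show ?thesis by blast
  qed (auto intro: exI[of _ 0])
  then have "\<exists>x. f x = y \<and> norm x \<le> 2 * L * norm y" for y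
    by (rule approx_surj_imp_bounded_preimage[OF f \<open>L \<ge> 0\<close>])
  then show ?thesis using \<open>L \<ge> 0\<close> by (intro exI[of _ "2 * L"]) simp
qed

section \<open>Bounded bilinear maps and reduction to self-adjoint contractions\<close>

lemma bounded_bilinear_plus:
  assumes "bounded_bilinear f" "bounded_bilinear g"
  shows "bounded_bilinear (\<lambda>x y. f x y + g x y)"
proof -
  interpret f: bounded_bilinear f by (rule assms)
  interpret g: bounded_bilinear g by (rule assms)
  obtain K where K: "\<And>x y. norm (f x y) \<le> norm x * norm y * K" using f.bounded by blast
  obtain L where L: "\<And>x y. norm (g x y) \<le> norm x * norm y * L" using g.bounded by blast
  show ?thesis
  proof
    have "norm (f x y + g x y) \<le> norm x * norm y * (K + L)" for x y
      using norm_triangle_mono[OF K L] by (simp add: distrib_left)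
    then show "\<exists>K. \<forall>x y. norm (f x y + g x y) \<le> norm x * norm y * K" by blast
  qed (simp_all add: f.add_left f.add_right g.add_left g.add_right f.scaleR_left f.scaleR_right
      g.scaleR_left g.scaleR_right scaleR_add_right)
qed

lemma bounded_bilinear_uminus:
  assumes "bounded_bilinear f"
  shows "bounded_bilinear (\<lambda>x y. - f x y)"
proof -
  interpret f: bounded_bilinear f by (rule assms)
  show ?thesis
    using f.bounded by unfold_locales
      (simp_all add: f.add_left f.add_right f.scaleR_left f.scaleR_right)
qed

lemma bounded_bilinear_minus:
  assumes "bounded_bilinear f" "bounded_bilinear g"
  shows "bounded_bilinear (\<lambda>x y. f x y - g x y)"
  using bounded_bilinear_plus[OF assms(1) bounded_bilinear_uminus[OF assms(2)]] by simp

lemma bounded_linear_scaleC: "bounded_linear (scaleC c :: 'a \<Rightarrow> 'a::complex_banach_algebra)"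
proof
  show "\<exists>K. \<forall>x::'a. norm (scaleC c x) \<le> norm x * K"
    by (intro exI[of _ "cmod c"]) (simp add: norm_scaleC mult.commute)
  show "scaleC c (r *\<^sub>R x) = r *\<^sub>R scaleC c (x::'a)" for r x
    by (simp flip: scaleC_of_real add: scaleC_scaleC mult.commute)
qed (rule scaleC_add_right)

lemma self_adjoint_decomposition:
  fixes a :: "'a::cstar_algebra"
  obtains b c where "a = b + scaleC \<i> c" "adj b = b" "adj c = c"
proof
  let ?b = "scaleC (1/2) (a + adj a)" and ?c = "scaleC (- \<i> / 2) (a - adj a)"
  show "adj ?b = ?b" by (simp add: adj_scaleC adj_add adj_adj add.commute)
  have neg: "scaleC (- d) x = - scaleC d x" for d and x :: 'a
    using scaleC_add_left[of d "- d" x] scaleC_of_real[of 0 x]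
    by (simp add: eq_neg_iff_add_eq_0 add.commute)
  have negr: "scaleC d (- x) = - scaleC d x" for d and x :: 'a
    using scaleC_add_right[of d x "- x"] scaleC_scaleC[of d 0 x] scaleC_of_real[of 0 x] scaleC_of_real[of 0 "0::'a"]
    by (metis add.right_inverse eq_neg_iff_add_eq_0 add.commute mult_zero_right of_real_0 scaleR_zero_left)
  show "adj ?c = ?c"
    by (simp add: adj_scaleC adj_diff adj_adj) (metis minus_diff_eq neg negr minus_minus minus_divide_left)
  have "?b + scaleC \<i> ?c = scaleC (1/2) ((a + adj a) + (a - adj a))"
    by (simp add: scaleC_scaleC flip: scaleC_add_right)
  also have "\<dots> = scaleC (1/2) (2 *\<^sub>R a)" by (simp add: scaleR_2)
  also have "\<dots> = a"
    by (simp add: scaleC_scaleC scaleC_of_real[of 1, simplified] flip: scaleC_of_real)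
  finally show "a = ?b + scaleC \<i> ?c" by simp
qed

lemma self_adjoint_induct:
  fixes a :: "'a::cstar_algebra"
  assumes sa: "\<And>k. adj k = k \<Longrightarrow> norm k \<le> 1 \<Longrightarrow> P k"
    and add: "\<And>x y. P x \<Longrightarrow> P y \<Longrightarrow> P (x + y)" and scale: "\<And>c x. P x \<Longrightarrow> P (scaleC c x)"
  shows "P a"
proof -
  have *: "P k" if k: "adj k = k" for k
  proof -
    define s where "s = 1 + norm k"
    have s: "s > 0" "norm k \<le> s" by (auto simp: s_def add_pos_nonneg)
    have "P ((1 / s) *\<^sub>R k)" using s k by (intro sa) (auto simp: adj_scaleR)
    then have "P (scaleC (complex_of_real s) ((1 / s) *\<^sub>R k))" by (rule scale)
    then show ?thesis using s by (simp add: scaleC_of_real)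
  qed
  obtain b c where "a = b + scaleC \<i> c" "adj b = b" "adj c = c"
    by (rule self_adjoint_decomposition)
  then show ?thesis by (auto intro: add scale *)
qed

section \<open>Maps preserving zero Jordan products\<close>

locale zero_jordan_product_map =
  fixes \<Phi> :: "'a::cstar_algebra \<Rightarrow> 'b::complex_banach_algebra"
  assumes clinear: "clinear \<Phi>" and continuous: "continuous_on UNIV \<Phi>"
    and zero: "\<And>a b. a * b = 0 \<Longrightarrow> b * a = 0 \<Longrightarrow> jordan_prod (\<Phi> a) (\<Phi> b) = 0"
begin

lemma \<Phi>_add: "\<Phi> (x + y) = \<Phi> x + \<Phi> y" and \<Phi>_scaleC: "\<Phi> (scaleC c x) = scaleC c (\<Phi> x)"
  using clinear by (auto simp: Vector_Spaces.linear_iff)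

lemma bounded_linear_\<Phi>: "bounded_linear \<Phi>"
proof -
  have lin: "linear \<Phi>"
  proof
    show "\<Phi> (r *\<^sub>R x) = r *\<^sub>R \<Phi> x" for r x
      using \<Phi>_scaleC[of "complex_of_real r" x] by (simp add: scaleC_of_real)
  qed (rule \<Phi>_add)
  have "continuous (at 0) \<Phi>"
    using continuous by (simp add: continuous_on_eq_continuous_at)
  then obtain d where d: "d > 0" "\<And>x. dist x 0 < d \<Longrightarrow> dist (\<Phi> x) (\<Phi> 0) < 1"
    unfolding continuous_at_eps_delta by (metis zero_less_one)
  have "norm (\<Phi> x) \<le> norm x * (2 / d)" for x
  proof (cases "x = 0")
    case False
    let ?s = "d / (2 * norm x)"
    have "norm (\<Phi> (?s *\<^sub>R x)) < 1"
      using d(2)[of "?s *\<^sub>R x"] d(1) False linear_0[OF lin] by simp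
    then have "?s * norm (\<Phi> x) < 1"
      using d(1) by (simp add: linear_cmul[OF lin])
    then show ?thesis using d(1) False by (simp add: field_simps)
  qed (simp add: linear_0[OF lin])
  then show ?thesis
    using lin by (intro bounded_linear.intro bounded_linear_axioms.intro) blast+
qed

sublocale \<Phi>: bounded_linear \<Phi> by (rule bounded_linear_\<Phi>)

definition \<phi> :: "'a \<Rightarrow> 'a \<Rightarrow> 'b"
  where "\<phi> a b = jordan_prod (\<Phi> a) (\<Phi> b)"

lemma bounded_bilinear_\<phi>: "bounded_bilinear \<phi>"
proof -
  have "bounded_bilinear (\<lambda>a b. \<Phi> a * \<Phi> b)"
    by (rule bounded_bilinear.comp[OF bounded_bilinear_mult bounded_linear_\<Phi> bounded_linear_\<Phi>])
  from bounded_bilinear_plus[OF this bounded_bilinear.flip[OF this]]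
  show ?thesis unfolding \<phi>_def [abs_def] jordan_prod_def .
qed

sublocale \<phi>: bounded_bilinear \<phi> by (rule bounded_bilinear_\<phi>)

lemma \<phi>_commute: "\<phi> a b = \<phi> b a"
  by (simp add: \<phi>_def jordan_prod_def add.commute)

lemma \<phi>_scaleC: "\<phi> (scaleC c a) b = scaleC c (\<phi> a b)"
  by (simp add: \<phi>_def jordan_prod_def \<Phi>_scaleC mult_scaleC_left mult_scaleC_right scaleC_add_right)

text \<open>For a thresholded \<open>x\<close> and a cutoff \<open>g\<close> with
  \<open>g x = x\<close>, symmetry of \<open>(a, b) \<mapsto> \<phi>(a x, b)\<close> says
  \<open>\<phi>(x, x) = \<phi>(x x, g)\<close>, and the right side is the limit of
  \<open>\<phi>(x x, w)\<close>. Letting the threshold tend to \<open>0\<close> gives the claim for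
  \<open>k\<close>.\<close>

lemma square_tendsto_contraction:
  assumes k: "adj k = k" "norm k \<le> 1"
  shows "((\<lambda>w. \<phi> (k * k) w) \<longlongrightarrow> \<phi> k k) approx_unit"
proof -
  interpret sa_contraction k by unfold_locales (rule k)+
  define x where "x = (\<lambda>n. fc k (soft (1 / real (Suc n))))"
  have xk: "x \<longlonglongrightarrow> k" unfolding x_def by (rule fc_soft_tendsto)
  have "((\<lambda>w. \<phi> (x n * x n) w) \<longlongrightarrow> \<phi> (x n) (x n)) approx_unit" for n
  proof -
    define \<delta> where "\<delta> = 1 / real (Suc n)"
    let ?s = "soft \<delta>" and ?c = "cutoff \<delta>"
    have \<delta>: "\<delta> > 0" by (simp add: \<delta>_def)
    note C = C0_soft[OF \<delta>] C0_cutoff[OF \<delta>]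
    have x: "x n = fc k ?s" by (simp add: x_def \<delta>_def)
    have cut: "?c t = 1" if "?s t \<noteq> 0" for t by (rule cutoff_eq_1[OF \<delta> that])
    have o\<phi>: "orth \<phi>"
      unfolding orth_def \<phi>_def using zero by blast
    have o\<psi>: "orth (\<lambda>a b. \<phi> (a * x n) b)"
      unfolding orth_def
    proof (intro allI impI)
      fix f b assume f: "C0 f"
        and b: "\<forall>c. C0 c \<longrightarrow> (\<forall>t. f t = 0 \<longrightarrow> c t = 0) \<longrightarrow> fc k c * b = 0 \<and> b * fc k c = 0"
      have "fc k f * x n = fc k (\<lambda>t. f t * ?s t)" using f C by (simp add: x fc_mult)
      moreover have "\<phi> (fc k (\<lambda>t. f t * ?s t)) b = 0"
        using b by (intro orthD[OF o\<phi>] C0_intros f C) simp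
      ultimately show "\<phi> (fc k f * x n) b = 0" by simp
    qed
    have bb: "bounded_bilinear (\<lambda>a b. \<phi> (a * x n) b)"
      by (rule bounded_bilinear.comp1[OF bounded_bilinear_\<phi> bounded_linear_mult_left])
    have gx: "fc k ?c * x n = x n"
    proof -
      have "fc k (\<lambda>t. ?c t * ?s t) = fc k ?s" by (rule fc_cong) (metis cut mult.left_neutral mult_zero_right)
      then show ?thesis using C by (simp add: x fc_mult)
    qed
    have "((\<lambda>w. \<phi> (fc k (\<lambda>t. ?s t * ?s t)) w) \<longlongrightarrow> \<phi> (fc k (\<lambda>t. ?s t * ?s t)) (fc k ?c)) approx_unit"
      by (rule orth_tendsto[OF bounded_bilinear_\<phi> o\<phi> C0_intros(4)[OF C(1) C(1)] C(2)]) (use cut in auto)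
    moreover have "fc k (\<lambda>t. ?s t * ?s t) = x n * x n" using C by (simp add: x fc_mult)
    moreover have "\<phi> (x n * x n) (fc k ?c) = \<phi> (x n) (x n)"
      using orth_symmetric[OF bb o\<psi> C(1) C(2)] cut by (simp add: gx x[symmetric])
    ultimately show ?thesis by simp
  qed
  then show ?thesis
    by (rule approx_unit_limit[OF bounded_bilinear_\<phi> tendsto_mult[OF xk xk] \<phi>.tendsto[OF xk xk]])
qed

lemma square_tendsto:
  assumes k: "adj k = k"
  shows "((\<lambda>w. \<phi> (k * k) w) \<longlongrightarrow> \<phi> k k) approx_unit"
proof -
  define s where "s = 1 + norm k"
  have s: "s > 0" "norm k \<le> s" by (auto simp: s_def add_pos_nonneg)
  let ?k = "(1 / s) *\<^sub>R k"
  have "((\<lambda>w. (s * s) *\<^sub>R \<phi> (?k * ?k) w) \<longlongrightarrow> (s * s) *\<^sub>R \<phi> ?k ?k) approx_unit"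
    using s k by (intro tendsto_intros square_tendsto_contraction) (auto simp: adj_scaleR)
  then show ?thesis using s by (simp add: \<phi>.scaleR_left \<phi>.scaleR_right)
qed

text \<open>A self-adjoint contraction is the difference of two squares of self-adjoint elements,
  the square roots of its positive and negative parts, and for squares the limit is known.\<close>

lemma \<phi>_limit_exists: "\<exists>l. ((\<lambda>w. \<phi> a w) \<longlongrightarrow> l) approx_unit"
proof (induction a rule: self_adjoint_induct)
  case (1 k)
  then interpret sa_contraction k by unfold_locales
  let ?p = "\<lambda>t::real. sqrt (max 0 t)" and ?q = "\<lambda>t::real. sqrt (max 0 (- t))"
  have C: "C0 ?p" "C0 ?q" by (auto simp: C0_def intro!: continuous_intros)
  have "fc k (\<lambda>t. t) = fc k (\<lambda>t. ?p t * ?p t - ?q t * ?q t)"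
    by (rule fc_cong) (auto simp: max_def)
  moreover have "fc k (\<lambda>t. ?p t * ?p t - ?q t * ?q t) = fc k ?p * fc k ?p - fc k ?q * fc k ?q"
    by (simp only: fc_diff fc_mult C C0_intros)
  ultimately have "fc k ?p * fc k ?p - fc k ?q * fc k ?q = k" by (simp add: fc_id)
  then have "\<phi> (fc k ?p * fc k ?p) w - \<phi> (fc k ?q * fc k ?q) w = \<phi> k w" for w
    by (simp flip: \<phi>.diff_left)
  moreover have "((\<lambda>w. \<phi> (fc k ?p * fc k ?p) w - \<phi> (fc k ?q * fc k ?q) w)
      \<longlongrightarrow> \<phi> (fc k ?p) (fc k ?p) - \<phi> (fc k ?q) (fc k ?q)) approx_unit"
    using C by (intro tendsto_diff square_tendsto fc_sa)
  ultimately show ?case by auto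
next
  case (2 x y)
  then obtain l m where "((\<lambda>w. \<phi> x w) \<longlongrightarrow> l) approx_unit" "((\<lambda>w. \<phi> y w) \<longlongrightarrow> m) approx_unit" by blast
  then have "((\<lambda>w. \<phi> x w + \<phi> y w) \<longlongrightarrow> l + m) approx_unit" by (rule tendsto_add)
  then show ?case by (auto simp: \<phi>.add_left)
next
  case (3 c x)
  then obtain l where "((\<lambda>w. \<phi> x w) \<longlongrightarrow> l) approx_unit" by blast
  then have "((\<lambda>w. scaleC c (\<phi> x w)) \<longlongrightarrow> scaleC c l) approx_unit"
    by (rule bounded_linear.tendsto[OF bounded_linear_scaleC])
  then show ?case by (auto simp: \<phi>_scaleC)
qed

section \<open>The limit map \<open>\<sigma>\<close> and the Jordan product\<close>

definition \<sigma> :: "'a \<Rightarrow> 'b"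
  where "\<sigma> a = (1/2) *\<^sub>R Lim approx_unit (\<phi> a)"

lemma \<sigma>_tendsto: "((\<lambda>w. \<phi> a w) \<longlongrightarrow> 2 *\<^sub>R \<sigma> a) approx_unit"
proof -
  obtain l where l: "(\<phi> a \<longlongrightarrow> l) approx_unit" using \<phi>_limit_exists by blast
  then have "Lim approx_unit (\<phi> a) = l" by (intro tendsto_Lim) auto
  then show ?thesis using l by (simp add: \<sigma>_def)
qed

lemma \<sigma>_eqI: "((\<lambda>w. \<phi> a w) \<longlongrightarrow> 2 *\<^sub>R l) approx_unit \<Longrightarrow> \<sigma> a = l"
  using tendsto_unique[OF approx_unit_nontrivial \<sigma>_tendsto, of a "2 *\<^sub>R l"] by simp

lemma \<sigma>_add: "\<sigma> (a + b) = \<sigma> a + \<sigma> b"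
  using tendsto_add[OF \<sigma>_tendsto[of a] \<sigma>_tendsto[of b]]
  by (intro \<sigma>_eqI) (simp add: \<phi>.add_left scaleR_add_right)

lemma scaleC_scaleR: "scaleC c (r *\<^sub>R x) = r *\<^sub>R scaleC c (x::'b)"
  by (rule bounded_linear.axioms(1)[OF bounded_linear_scaleC, THEN linear_cmul])

lemma \<sigma>_scaleC: "\<sigma> (scaleC c a) = scaleC c (\<sigma> a)"
  using bounded_linear.tendsto[OF bounded_linear_scaleC \<sigma>_tendsto[of a], of c]
  by (intro \<sigma>_eqI) (simp add: \<phi>_scaleC scaleC_scaleR)

lemma bounded_linear_\<sigma>: "bounded_linear \<sigma>"
proof
  show "\<sigma> (r *\<^sub>R a) = r *\<^sub>R \<sigma> a" for r a
    using \<sigma>_scaleC[of "complex_of_real r" a] by (simp add: scaleC_of_real)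
  obtain K where K: "K \<ge> 0" "\<And>a b. norm (\<phi> a b) \<le> norm a * norm b * K"
    using \<phi>.nonneg_bounded by blast
  have "norm (2 *\<^sub>R \<sigma> a) \<le> norm a * 8 * K" for a
  proof (rule tendsto_upperbound[OF tendsto_norm[OF \<sigma>_tendsto]])
    show "\<forall>\<^sub>F w in approx_unit. norm (\<phi> a w) \<le> norm a * 8 * K"
      using approx_unit_bounded
      by eventually_elim (rule order_trans[OF K(2)], intro mult_mono; simp add: K)
  qed simp
  then have "norm (\<sigma> a) \<le> norm a * (4 * K)" for a
    by (simp add: mult_ac)
  then show "\<exists>K. \<forall>a. norm (\<sigma> a) \<le> norm a * K" by blast
qed (rule \<sigma>_add)

sublocale \<sigma>: bounded_linear \<sigma> by (rule bounded_linear_\<sigma>)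

lemma \<sigma>_square: "adj k = k \<Longrightarrow> \<phi> k k = 2 *\<^sub>R \<sigma> (k * k)"
  using tendsto_unique[OF approx_unit_nontrivial square_tendsto \<sigma>_tendsto] by simp

text \<open>Polarization of \<open>\<sigma>_square\<close> covers self-adjoint pairs; complex
  linearity then extends the identity in one variable at a time.\<close>

lemma \<sigma>_jordan: "\<phi> a b = \<sigma> (jordan_prod a b)"
proof -
  have sa: "\<phi> a b = \<sigma> (jordan_prod a b)" if ab: "adj a = a" "adj b = b" for a b
  proof -
    have "\<phi> (a + b) (a + b) = 2 *\<^sub>R \<sigma> ((a + b) * (a + b))" "\<phi> a a = 2 *\<^sub>R \<sigma> (a * a)" "\<phi> b b = 2 *\<^sub>R \<sigma> (b * b)"
      using ab by (auto intro!: \<sigma>_square simp: adj_add)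
    then have "2 *\<^sub>R \<phi> a b = 2 *\<^sub>R \<sigma> (jordan_prod a b)"
      by (simp add: \<phi>.add_left \<phi>.add_right \<phi>_commute[of b a] jordan_prod_def distrib_left distrib_right
          \<sigma>_add scaleR_add_right scaleR_2)
    then show ?thesis by simp
  qed
  have half: "\<phi> a b = \<sigma> (jordan_prod a b)" if b: "adj b = b" for a b
  proof (induction a rule: self_adjoint_induct)
    case (2 x y)
    then show ?case by (simp add: \<phi>.add_left jordan_prod_def distrib_left distrib_right \<sigma>_add)
  next
    case (3 c x)
    then show ?case
      by (simp add: \<phi>_scaleC jordan_prod_def mult_scaleC_left mult_scaleC_right \<sigma>_scaleC flip: scaleC_add_right)
  qed (use sa b in blast)
  show ?thesis
  proof (induction b rule: self_adjoint_induct)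
    case (2 x y)
    then show ?case by (simp add: \<phi>.add_right jordan_prod_def distrib_left distrib_right \<sigma>_add)
  next
    case (3 c x)
    then show ?case
      by (simp add: \<phi>_commute[of a] \<phi>_scaleC jordan_prod_def mult_scaleC_left mult_scaleC_right \<sigma>_scaleC flip: scaleC_add_right)
  qed (use half in blast)
qed

section \<open>Asymptotic commutation along the approximate unit\<close>

definition \<kappa> :: "'b \<Rightarrow> 'a \<Rightarrow> 'b"
  where "\<kappa> u a = u * \<Phi> a - \<Phi> a * u"

lemma bounded_bilinear_\<kappa>: "bounded_bilinear \<kappa>"
  unfolding \<kappa>_def [abs_def]
  by (intro bounded_bilinear_minus bounded_bilinear.comp[OF bounded_bilinear_mult bounded_linear_ident bounded_linear_\<Phi>]
      bounded_bilinear.flip[OF bounded_bilinear.comp[OF bounded_bilinear_mult bounded_linear_\<Phi> bounded_linear_ident]])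

sublocale \<kappa>: bounded_bilinear \<kappa> by (rule bounded_bilinear_\<kappa>)

lemma \<kappa>_scaleC: "\<kappa> (scaleC c u) a = scaleC c (\<kappa> u a)"
proof -
  have "scaleC c (x - y) = scaleC c x - scaleC c y" for x y :: 'b
    by (rule linear_diff[OF bounded_linear.axioms(1)[OF bounded_linear_scaleC]])
  then show ?thesis by (simp add: \<kappa>_def mult_scaleC_left mult_scaleC_right)
qed

lemma commutator_tendsto_contraction:
  assumes k: "adj k = k" "norm k \<le> 1"
  shows "((\<lambda>w. \<kappa> (\<sigma> k) w) \<longlongrightarrow> 0) approx_unit"
proof -
  interpret sa_contraction k by unfold_locales (rule k)+
  define x where "x = (\<lambda>n. fc k (soft (1 / real (Suc n))))"
  have xk: "x \<longlonglongrightarrow> k" unfolding x_def by (rule fc_soft_tendsto)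
  have bb: "bounded_bilinear (\<lambda>a b. \<kappa> (\<sigma> a) b)"
    by (rule bounded_bilinear.comp1[OF bounded_bilinear_\<kappa> bounded_linear_\<sigma>])
  have o: "orth (\<lambda>a b. \<kappa> (\<sigma> a) b)"
    unfolding orth_def
  proof (intro allI impI)
    fix f b assume f: "C0 f"
      and b: "\<forall>c. C0 c \<longrightarrow> (\<forall>t. f t = 0 \<longrightarrow> c t = 0) \<longrightarrow> fc k c * b = 0 \<and> b * fc k c = 0"
    \<comment> \<open>The library's \<open>sqrt\<close> is odd, so
      \<open>sqrt |y| * sqrt y = y\<close> for either sign. Both factors vanish where
      \<open>f\<close> does, hence are orthogonal to \<open>b\<close>.\<close>
    let ?p = "\<lambda>t. sqrt \<bar>f t\<bar>" and ?q = "\<lambda>t. sqrt (f t)"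
    have C: "C0 ?p" "C0 ?q"
      using f by (auto simp: C0_def intro!: continuous_intros)
    define u where "u = fc k ?p"
    define v where "v = fc k ?q"
    have "sqrt \<bar>y\<bar> * sqrt y = y" for y :: real
      by (cases "y \<ge> 0") (simp_all add: real_sqrt_minus)
    then have "fc k f = u * v"
      using C by (simp add: u_def v_def flip: fc_mult)
    moreover have "v * u = u * v" using C by (simp add: u_def v_def fc_commute)
    ultimately have "\<phi> u v = \<sigma> (fc k f + fc k f)" by (simp add: \<sigma>_jordan jordan_prod_def)
    then have uv: "2 *\<^sub>R \<sigma> (fc k f) = \<phi> u v" by (simp add: \<sigma>_add scaleR_2)
    have "jordan_prod (\<Phi> u) (\<Phi> b) = 0" "jordan_prod (\<Phi> v) (\<Phi> b) = 0"
      using b C by (auto intro!: zero simp: u_def v_def)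
    then have a: "\<Phi> u * \<Phi> b = - (\<Phi> b * \<Phi> u)" "\<Phi> v * \<Phi> b = - (\<Phi> b * \<Phi> v)"
      by (auto simp: jordan_prod_def eq_neg_iff_add_eq_0)
    have "\<Phi> u * \<Phi> v * \<Phi> b = \<Phi> b * (\<Phi> u * \<Phi> v)" "\<Phi> v * \<Phi> u * \<Phi> b = \<Phi> b * (\<Phi> v * \<Phi> u)"
      by (metis (no_types) a minus_minus mult.assoc mult_minus_left mult_minus_right)+
    then have "\<kappa> (\<phi> u v) b = 0"
      by (simp add: \<kappa>_def \<phi>_def jordan_prod_def distrib_left distrib_right)
    then have "2 *\<^sub>R \<kappa> (\<sigma> (fc k f)) b = 0" by (simp flip: uv \<kappa>.scaleR_left)
    then show "\<kappa> (\<sigma> (fc k f)) b = 0" by simp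
  qed
  have lim: "((\<lambda>w. \<kappa> (\<sigma> (x n)) w) \<longlongrightarrow> 0) approx_unit" for n
  proof -
    define \<delta> where "\<delta> = 1 / real (Suc n)"
    let ?s = "soft \<delta>" and ?c = "cutoff \<delta>"
    have \<delta>: "\<delta> > 0" by (simp add: \<delta>_def)
    note C = C0_soft[OF \<delta>] C0_cutoff[OF \<delta>]
    define g where "g = fc k ?c"
    have x: "x n = fc k ?s" by (simp add: x_def \<delta>_def)
    have cut: "?c t = 1" if "?s t \<noteq> 0" for t by (rule cutoff_eq_1[OF \<delta> that])
    have "fc k (\<lambda>t. ?c t * ?s t) = fc k ?s" by (rule fc_cong) (metis cut mult.left_neutral mult_zero_right)
    then have gx: "g * x n = x n" "x n * g = x n"
      using C by (auto simp: x g_def fc_mult fc_commute)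
    have sym: "\<kappa> (\<sigma> g) (x n) = \<kappa> (\<sigma> (x n)) g"
      using orth_symmetric[OF bb o C(1) C(2)] cut by (simp add: g_def x)
    have gg: "\<kappa> (\<sigma> (g * g)) (x n) = \<kappa> (\<sigma> g) (x n)"
    proof -
      have "\<kappa> (\<sigma> (fc k (\<lambda>t. ?c t * ?c t - ?c t))) (fc k ?s) = 0"
      proof (rule orth_disjoint[OF o C0_intros(2)[OF C0_intros(4)[OF C(2) C(2)] C(2)] C(1)])
        show "?s t = 0" if "?c t * ?c t - ?c t \<noteq> 0" for t
          using cut[of t] that by auto
      qed
      then show ?thesis
        using C by (simp add: fc_diff fc_mult C0_intros g_def x \<sigma>.diff \<kappa>.diff_left)
    qed
    \<comment> \<open>The cyclic commutator identity for \<open>x n\<close>, \<open>g\<close>,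
      \<open>g\<close>. By \<open>gx\<close>, \<open>gg\<close> and \<open>sym\<close> its three
      terms coincide, so each of them is \<open>0\<close>.\<close>
    have "\<kappa> (\<phi> (x n) g) g + \<kappa> (\<phi> g g) (x n) + \<kappa> (\<phi> g (x n)) g = 0"
      by (simp add: \<kappa>_def \<phi>_def jordan_prod_def algebra_simps)
    moreover have "\<phi> (x n) g = 2 *\<^sub>R \<sigma> (x n)" "\<phi> g (x n) = 2 *\<^sub>R \<sigma> (x n)" "\<phi> g g = 2 *\<^sub>R \<sigma> (g * g)"
      by (simp_all add: \<sigma>_jordan jordan_prod_def gx \<sigma>_add scaleR_2)
    ultimately have "2 *\<^sub>R \<kappa> (\<sigma> (x n)) g + 2 *\<^sub>R \<kappa> (\<sigma> (x n)) g + 2 *\<^sub>R \<kappa> (\<sigma> (x n)) g = 0"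
      by (simp add: \<kappa>.scaleR_left gg sym)
    then have "6 *\<^sub>R \<kappa> (\<sigma> (x n)) g = 0" by (simp flip: scaleR_add_left)
    then have z: "\<kappa> (\<sigma> (x n)) g = 0" by simp
    have "((\<lambda>w. \<kappa> (\<sigma> (fc k ?s)) w) \<longlongrightarrow> \<kappa> (\<sigma> (fc k ?s)) (fc k ?c)) approx_unit"
      by (rule orth_tendsto[OF bb o C]) (use cut in auto)
    then show ?thesis using z by (simp add: x g_def)
  qed
  show ?thesis
    by (rule approx_unit_limit[OF bb xk tendsto_const lim])
qed

lemma commutator_tendsto: "((\<lambda>w. \<kappa> (\<sigma> a) w) \<longlongrightarrow> 0) approx_unit"
proof (induction a rule: self_adjoint_induct)
  case (1 k)
  then show ?case by (rule commutator_tendsto_contraction)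
next
  case (2 x y)
  then show ?case using tendsto_add[OF 2] by (simp add: \<sigma>_add \<kappa>.add_left)
next
  case (3 c x)
  have "((\<lambda>w. scaleC c (\<kappa> (\<sigma> x) w)) \<longlongrightarrow> scaleC c 0) approx_unit"
    by (rule bounded_linear.tendsto[OF bounded_linear_scaleC 3])
  moreover have "scaleC c 0 = (0::'b)"
    by (rule linear_0[OF bounded_linear.axioms(1)[OF bounded_linear_scaleC]])
  ultimately show ?case by (simp add: \<sigma>_scaleC \<kappa>_scaleC)
qed

text \<open>By surjectivity every Jordan product in \<open>B\<close> has the form
  \<open>\<phi> a c\<close>, hence lies in the range of \<open>\<sigma>\<close>. The assumption says
  that such products approximate \<open>2 u\<close>.\<close>

lemma commutator_tendsto_0:
  assumes approx: "\<And>\<epsilon>. \<epsilon> > 0 \<Longrightarrow> \<exists>d. norm (jordan_prod u d - 2 *\<^sub>R u) \<le> \<epsilon>"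
    and surj: "surj \<Phi>"
  shows "((\<lambda>w. \<kappa> u w) \<longlongrightarrow> 0) approx_unit"
proof -
  have "\<forall>n. \<exists>a. norm (2 *\<^sub>R u - \<sigma> a) \<le> 1 / real (Suc n)"
  proof
    fix n
    obtain d where d: "norm (jordan_prod u d - 2 *\<^sub>R u) \<le> 1 / real (Suc n)"
      using approx[of "1 / real (Suc n)"] by auto
    obtain a c where "u = \<Phi> a" "d = \<Phi> c" using surj by blast
    then have "jordan_prod u d = \<sigma> (jordan_prod a c)" by (simp flip: \<sigma>_jordan add: \<phi>_def)
    then show "\<exists>a. norm (2 *\<^sub>R u - \<sigma> a) \<le> 1 / real (Suc n)"
      using d by (metis norm_minus_commute)
  qed
  then obtain a where a: "\<And>n. norm (2 *\<^sub>R u - \<sigma> (a n)) \<le> 1 / real (Suc n)" by metis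
  have lim: "(\<lambda>n. 1 / real (Suc n)) \<longlonglongrightarrow> 0"
    using LIMSEQ_inverse_real_of_nat by (simp add: inverse_eq_divide)
  have "(\<lambda>n. 2 *\<^sub>R u - \<sigma> (a n)) \<longlonglongrightarrow> 0"
    by (rule Lim_null_comparison[OF _ lim]) (use a in simp)
  from tendsto_diff[OF tendsto_const[of "2 *\<^sub>R u"] this]
  have "(\<lambda>n. \<sigma> (a n)) \<longlonglongrightarrow> 2 *\<^sub>R u" by simp
  from approx_unit_limit[OF bounded_bilinear_\<kappa> this tendsto_const commutator_tendsto]
  have "((\<lambda>w. \<kappa> (2 *\<^sub>R u) w) \<longlongrightarrow> 0) approx_unit" .
  from tendsto_scaleR[OF tendsto_const[of "1/2"] this] show ?thesis
    by (simp add: \<kappa>.scaleR_left)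
qed

end

section \<open>The centralizer \<open>W\<close> and its bijectivity\<close>

locale onto_zero_jordan_product_map = zero_jordan_product_map \<Phi>
  for \<Phi> :: "'a::cstar_algebra \<Rightarrow> 'b::complex_banach_algebra" +
  fixes C :: real
  assumes surj: "surj \<Phi>"
    and approx: "\<And>(u :: 'b) \<epsilon>. \<epsilon> > 0 \<Longrightarrow> \<exists>d. norm d \<le> C \<and> norm (d * u - u) \<le> \<epsilon> \<and> norm (u * d - u) \<le> \<epsilon>"
begin

lemma jordan_approx:
  fixes u :: 'b
  assumes "\<epsilon> > 0"
  shows "\<exists>d. norm d \<le> C \<and> norm (jordan_prod u d - 2 *\<^sub>R u) \<le> \<epsilon>"
proof -
  obtain d where d: "norm d \<le> C" "norm (d * u - u) \<le> \<epsilon> / 2" "norm (u * d - u) \<le> \<epsilon> / 2"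
    using approx[of "\<epsilon> / 2" u] assms by auto
  have "jordan_prod u d - 2 *\<^sub>R u = (u * d - u) + (d * u - u)"
    by (simp add: jordan_prod_def scaleR_2)
  then have "norm (jordan_prod u d - 2 *\<^sub>R u) \<le> \<epsilon> / 2 + \<epsilon> / 2"
    using norm_triangle_mono d by metis
  then show ?thesis using d by auto
qed

text \<open>Both one-sided products are half the sum or half the difference of the Jordan product
  and the commutator, whose limits are \<open>2 \<sigma>(a)\<close> and \<open>0\<close>.\<close>

lemma mult_tendsto: "((\<lambda>w. \<Phi> a * \<Phi> w) \<longlongrightarrow> \<sigma> a) approx_unit" "((\<lambda>w. \<Phi> w * \<Phi> a) \<longlongrightarrow> \<sigma> a) approx_unit"
proof -
  have \<kappa>: "((\<lambda>w. \<kappa> (\<Phi> a) w) \<longlongrightarrow> 0) approx_unit"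
    by (rule commutator_tendsto_0[OF _ surj]) (use jordan_approx in blast)
  from tendsto_scaleR[OF tendsto_const[of "1/2"] tendsto_add[OF \<sigma>_tendsto[of a] \<kappa>]]
  show "((\<lambda>w. \<Phi> a * \<Phi> w) \<longlongrightarrow> \<sigma> a) approx_unit"
    by (simp add: \<kappa>_def \<phi>_def jordan_prod_def flip: scaleR_2)
  from tendsto_scaleR[OF tendsto_const[of "1/2"] tendsto_diff[OF \<sigma>_tendsto[of a] \<kappa>]]
  show "((\<lambda>w. \<Phi> w * \<Phi> a) \<longlongrightarrow> \<sigma> a) approx_unit"
    by (simp add: \<kappa>_def \<phi>_def jordan_prod_def flip: scaleR_2)
qed

lemma \<sigma>_mult: "\<sigma> a * \<Phi> b = \<Phi> a * \<sigma> b"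
proof -
  have "((\<lambda>w. \<Phi> a * \<Phi> w * \<Phi> b) \<longlongrightarrow> \<sigma> a * \<Phi> b) approx_unit"
    by (intro tendsto_intros mult_tendsto)
  moreover have "((\<lambda>w. \<Phi> a * (\<Phi> w * \<Phi> b)) \<longlongrightarrow> \<Phi> a * \<sigma> b) approx_unit"
    by (intro tendsto_intros mult_tendsto)
  ultimately show ?thesis
    by (intro tendsto_unique[OF approx_unit_nontrivial]) (simp_all add: mult.assoc)
qed

lemma left_annihilator_trivial:
  fixes u :: 'b
  assumes "\<And>x. u * x = 0"
  shows "u = 0"
proof -
  have "norm u \<le> 0 + \<epsilon>" if \<epsilon>: "\<epsilon> > 0" for \<epsilon>
    using approx[OF \<epsilon>, of u] assms by auto
  then have "norm u \<le> 0" by (rule field_le_epsilon)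
  then show ?thesis by simp
qed

definition W :: "'b \<Rightarrow> 'b"
  where "W u = \<sigma> (inv \<Phi> u)"

text \<open>The choice of preimage is immaterial: if \<open>\<Phi>(d) = 0\<close>, then
  \<open>\<sigma>(d) \<Phi>(b) = \<Phi>(d) \<sigma>(b) = 0\<close> for all \<open>b\<close>, so
  \<open>\<sigma>(d)\<close> annihilates \<open>B\<close>.\<close>

lemma W_\<Phi>: "W (\<Phi> a) = \<sigma> a"
proof -
  let ?d = "inv \<Phi> (\<Phi> a) - a"
  have "\<Phi> ?d = 0" using surj by (simp add: \<Phi>.diff surj_f_inv_f)
  then have "\<sigma> ?d * \<Phi> b = 0" for b by (simp add: \<sigma>_mult)
  then have "\<sigma> ?d * x = 0" for x using surj by (metis surj_f_inv_f)
  then have "\<sigma> ?d = 0" by (rule left_annihilator_trivial)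
  then show ?thesis by (simp add: W_def \<sigma>.diff)
qed

lemma W_mult: "W u * v = u * W v"
proof -
  obtain a b where "u = \<Phi> a" "v = \<Phi> b" using surj by blast
  then show ?thesis by (simp add: W_\<Phi> \<sigma>_mult)
qed

lemma W_mult_left: "W (u * v) = W u * v" and W_mult_right: "W (u * v) = u * W v"
proof -
  have "(W (u * v) - u * W v) * t = 0" for t
    by (simp add: left_diff_distrib W_mult mult.assoc)
  then have "W (u * v) - u * W v = 0" by (rule left_annihilator_trivial)
  then show "W (u * v) = u * W v" by simp
  then show "W (u * v) = W u * v" by (simp add: W_mult)
qed

lemma W_jordan: "W (\<Phi> (jordan_prod a b)) = jordan_prod (\<Phi> a) (\<Phi> b)"
  by (simp add: W_\<Phi> flip: \<sigma>_jordan add: \<phi>_def)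

lemma W_add: "W (u + v) = W u + W v"
proof -
  obtain a b where "u = \<Phi> a" "v = \<Phi> b" using surj by blast
  then show ?thesis by (simp add: W_\<Phi> \<sigma>_add flip: \<Phi>_add)
qed

lemma W_scaleC: "W (scaleC c u) = scaleC c (W u)"
proof -
  obtain a where "u = \<Phi> a" using surj by blast
  then show ?thesis by (simp add: W_\<Phi> \<sigma>_scaleC flip: \<Phi>_scaleC)
qed

lemma bounded_linear_W: "bounded_linear W"
proof
  show "W (r *\<^sub>R u) = r *\<^sub>R W u" for r u
    using W_scaleC[of "complex_of_real r" u] by (simp add: scaleC_of_real)
  obtain K where K: "K \<ge> 0" "\<And>y. \<exists>x. \<Phi> x = y \<and> norm x \<le> K * norm y"
    using bounded_preimage[OF bounded_linear_\<Phi> surj] by blast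
  obtain L where L: "L \<ge> 0" "\<And>a. norm (\<sigma> a) \<le> norm a * L"
    using \<sigma>.nonneg_bounded by blast
  have "norm (W u) \<le> norm u * (K * L)" for u
  proof -
    obtain a where a: "\<Phi> a = u" "norm a \<le> K * norm u" using K(2) by blast
    have "norm (W u) \<le> norm a * L" using L(2)[of a] a(1) by (auto simp: W_\<Phi>)
    also have "\<dots> \<le> K * norm u * L" using a(2) L(1) by (rule mult_right_mono)
    finally show ?thesis by (simp add: mult_ac)
  qed
  then show "\<exists>K. \<forall>u. norm (W u) \<le> norm u * K" by blast
qed (rule W_add)

sublocale W: bounded_linear W by (rule bounded_linear_W)

text \<open>If \<open>W(t) = 0\<close>, then \<open>t W(x) = W(t) x = 0\<close>, so \<open>t\<close>
  annihilates the range of \<open>W\<close>. That range contains every Jordan product, in particular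
  elements arbitrarily close to \<open>2 x\<close>.\<close>

lemma inj_W: "inj W"
proof (rule injI)
  fix u v assume "W u = W v"
  then have "W (u - v) = 0" by (simp add: W.diff)
  then have zero: "(u - v) * W x = 0" for x using W_mult[of "u - v" x] by simp
  define t where "t = u - v"
  have tj: "t * jordan_prod x y = 0" for x y
  proof -
    obtain a b where "x = \<Phi> a" "y = \<Phi> b" using surj by blast
    then show ?thesis using zero by (simp add: t_def flip: W_jordan)
  qed
  have "t * x = 0" for x
  proof -
    have "norm (2 *\<^sub>R (t * x)) \<le> 0 + \<epsilon>" if \<epsilon>: "\<epsilon> > 0" for \<epsilon>
    proof -
      define \<eta> where "\<eta> = \<epsilon> / (norm t + 1)"
      have den: "norm t + 1 > 0" by (simp add: add_nonneg_pos)
      then have \<eta>: "\<eta> > 0" "\<eta> * (norm t + 1) = \<epsilon>" using \<epsilon> by (simp_all add: \<eta>_def)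
      obtain d where d: "norm (jordan_prod x d - 2 *\<^sub>R x) \<le> \<eta>" using jordan_approx[OF \<eta>(1)] by blast
      have "t * (jordan_prod x d - 2 *\<^sub>R x) = - (2 *\<^sub>R (t * x))" by (simp add: right_diff_distrib tj)
      then have "norm (2 *\<^sub>R (t * x)) = norm (t * (jordan_prod x d - 2 *\<^sub>R x))" by simp
      also have "\<dots> \<le> norm t * \<eta>"
        by (rule order_trans[OF norm_mult_ineq]) (intro mult_left_mono d norm_ge_zero)
      also have "\<dots> \<le> \<epsilon>" using \<eta> by (simp add: algebra_simps)
      finally show ?thesis by simp
    qed
    then have "norm (2 *\<^sub>R (t * x)) \<le> 0" by (rule field_le_epsilon)
    then show ?thesis by simp
  qed
  then have "t = 0" by (rule left_annihilator_trivial)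
  then show "u = v" by (simp add: t_def)
qed

text \<open>With \<open>\<Phi>(a) = u\<close> and \<open>\<Phi>(c) = d\<close> for an approximate
  unit \<open>d\<close> of \<open>u\<close>, the element \<open>\<Phi>(a \<circ> c) / 2\<close> is
  mapped by \<open>W\<close> to \<open>(u \<circ> d) / 2\<close>, which is close to
  \<open>u\<close>. Controlled preimages allow this to be iterated.\<close>

lemma surj_W: "surj W"
proof -
  obtain K where K: "K \<ge> 0" "\<And>y. \<exists>x. \<Phi> x = y \<and> norm x \<le> K * norm y"
    using bounded_preimage[OF bounded_linear_\<Phi> surj] by blast
  obtain M where M: "M \<ge> 0" "\<And>x. norm (\<Phi> x) \<le> norm x * M"
    using \<Phi>.nonneg_bounded by blast
  have "C \<ge> 0" using approx[of 1 0] norm_ge_zero order_trans by (metis zero_less_one)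
  \<comment> \<open>\<open>M\<close> bounds \<open>\<Phi>\<close>, each \<open>K\<close> one
    preimage under \<open>\<Phi>\<close>, and \<open>C\<close> the approximate unit. The two terms
    of the Jordan product cancel the factor \<open>1/2\<close> of \<open>?v\<close>.\<close>
  define L where "L = M * (K * (K * C))"
  have L: "L \<ge> 0" using K M \<open>C \<ge> 0\<close> by (simp add: L_def)
  have "\<exists>v. norm v \<le> L * norm u \<and> norm (u - W v) \<le> norm u / 2" for u
  proof (cases "u = 0")
    case False
    then obtain d where d: "norm d \<le> C" "norm (jordan_prod u d - 2 *\<^sub>R u) \<le> norm u"
      using jordan_approx[of "norm u" u] by auto
    obtain a where a: "\<Phi> a = u" "norm a \<le> K * norm u" using K(2) by blast
    obtain c where c: "\<Phi> c = d" "norm c \<le> K * norm d" using K(2) by blast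
    have nc: "norm c \<le> K * C" using c(2) mult_left_mono[OF d(1) K(1)] by linarith
    let ?v = "(1/2) *\<^sub>R \<Phi> (jordan_prod a c)"
    have "norm (jordan_prod a c) \<le> norm a * norm c + norm c * norm a"
      unfolding jordan_prod_def by (intro norm_triangle_mono norm_mult_ineq)
    also have "\<dots> \<le> 2 * ((K * norm u) * (K * C))"
      using mult_mono[OF a(2) nc] K(1) by (simp add: mult.commute)
    finally have "norm (\<Phi> (jordan_prod a c)) \<le> 2 * ((K * norm u) * (K * C)) * M"
      by (rule order_trans[OF M(2) mult_right_mono[OF _ M(1)]])
    then have "norm ?v \<le> L * norm u" by (simp add: L_def mult_ac)
    moreover have "norm (u - W ?v) \<le> norm u / 2"
    proof -
      have "u - W ?v = (- (1/2)) *\<^sub>R (jordan_prod u d - 2 *\<^sub>R u)"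
        by (simp add: W.scaleR W_jordan a c scaleR_diff_right)
      then show ?thesis using d(2) by simp
    qed
    ultimately show ?thesis by blast
  qed (auto intro: exI[of _ 0])
  from approx_surj_imp_bounded_preimage[OF bounded_linear_W L this]
  show ?thesis by (metis surjI)
qed

theorem weighted: "weighted_jordan_hom \<Phi>"
proof -
  have bij: "bij W" using inj_W surj_W by (rule bijI)
  define \<Psi> where "\<Psi> = inv W \<circ> \<Phi>"
  have W\<Psi>: "W (\<Psi> a) = \<Phi> a" for a by (simp add: \<Psi>_def surj_W surj_f_inv_f)
  have eqI: "x = y" if "W x = W y" for x y using inj_W that by (rule injD)
  have "\<Psi> (a + b) = \<Psi> a + \<Psi> b" for a b
    by (rule eqI) (simp add: W_add W\<Psi> \<Phi>_add)
  moreover have "\<Psi> (scaleC c a) = scaleC c (\<Psi> a)" for c a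
    by (rule eqI) (simp add: W_scaleC W\<Psi> \<Phi>_scaleC)
  moreover have "\<Psi> (jordan_prod a b) = jordan_prod (\<Psi> a) (\<Psi> b)" for a b
  \<comment> \<open>Applying \<open>W\<close> twice supplies one \<open>W\<close> for each factor of
    a product, so both sides become \<open>\<Phi>(a) \<circ> \<Phi>(b)\<close>.\<close>
  proof (rule eqI, rule eqI)
    have "W (W (x * y)) = W x * W y" for x y by (metis W_mult_left W_mult_right)
    then have "W (W (jordan_prod x y)) = jordan_prod (W x) (W y)" for x y
      by (simp add: jordan_prod_def W_add)
    then show "W (W (\<Psi> (jordan_prod a b))) = W (W (jordan_prod (\<Psi> a) (\<Psi> b)))"
      by (simp add: W\<Psi> W_jordan)
  qed
  ultimately have "jordan_hom \<Psi>"
    by (simp add: jordan_hom_def Vector_Spaces.linear_iff vector_space_scaleC)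
  moreover have "centralizer W"
    unfolding centralizer_def Vector_Spaces.linear_iff
    by (simp add: vector_space_scaleC W_add W_scaleC) (metis W_mult_left W_mult_right)
  moreover have "\<Phi> = W \<circ> \<Psi>" by (simp add: fun_eq_iff W\<Psi>)
  ultimately show ?thesis
    unfolding weighted_jordan_hom_def using clinear bij by blast
qed

end

theorem theorem3p3:
  fixes \<Phi> :: "'a::cstar_algebra \<Rightarrow> 'b::complex_banach_algebra"
    and I :: "'i set" and le :: "'i \<Rightarrow> 'i \<Rightarrow> bool" and e :: "'i \<Rightarrow> 'b"
  assumes "bounded_approx_identity I le e"
    and "clinear \<Phi>"
    and "continuous_on UNIV \<Phi>"
    and "surj \<Phi>"
    and "\<And>a b. a * b = 0 \<Longrightarrow> b * a = 0 \<Longrightarrow> jordan_prod (\<Phi> a) (\<Phi> b) = 0"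
  shows "weighted_jordan_hom \<Phi>"
proof -
  obtain C where C: "\<And>i. i \<in> I \<Longrightarrow> norm (e i) \<le> C" and dir: "directed_by I le"
    and lim: "\<And>b. net_tendsto I le (\<lambda>i. e i * b) b" "\<And>b. net_tendsto I le (\<lambda>i. b * e i) b"
    using assms(1) unfolding bounded_approx_identity_def by blast
  have "\<exists>d. norm d \<le> C \<and> norm (d * u - u) \<le> \<epsilon> \<and> norm (u * d - u) \<le> \<epsilon>" if \<epsilon>: "\<epsilon> > 0" for u :: 'b and \<epsilon>
  proof -
    obtain i where i: "i \<in> I" "\<And>j. j \<in> I \<Longrightarrow> le i j \<Longrightarrow> norm (e j * u - u) < \<epsilon>"
      using lim(1)[of u] \<epsilon> unfolding net_tendsto_def by blast
    obtain j where j: "j \<in> I" "\<And>k. k \<in> I \<Longrightarrow> le j k \<Longrightarrow> norm (u * e k - u) < \<epsilon>"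
      using lim(2)[of u] \<epsilon> unfolding net_tendsto_def by blast
    obtain k where "k \<in> I" "le i k" "le j k"
      using dir i(1) j(1) unfolding directed_by_def by blast
    then show ?thesis using C i(2) j(2) by (intro exI[of _ "e k"]) (auto intro: less_imp_le)
  qed
  with assms(2-5) interpret onto_zero_jordan_product_map \<Phi> C
    by (intro onto_zero_jordan_product_map.intro zero_jordan_product_map.intro
        onto_zero_jordan_product_map_axioms.intro)
  show ?thesis by (rule weighted)
qed

end
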